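(* If $K$ is a non-metrizable compact Hausdorff space, then the free locally convex space $L(K)$ over $K$ is a $(df)$-space but not a quasi-$(DF)$-space.
   Context: Locally convex spaces (lcs) are real and Hausdorff; Tychonoff means completely regular and Hausdorff. The free locally convex space over a Tychonoff space $X$ is an lcs $L(X)$ with a continuous map $i:X\to L(X)$ such that for every continuous map $f$ from $X$ to an lcs $E$ there is a unique continuous linear operator $\bar f:L(X)\to E$ with $f=\bar f\circ i$. It exists and is essentially unique, and $i$ is a topological embedding whose image is a Hamel basis of $L(X)$. For an lcs $E$ with dual $E'$, $\beta(E',E)$ is the strong topology (uniform convergence on bounded subsets of $E$). A subset of $E'$ is equicontinuous if it is contained in the polar $U^\circ=\{\chi\in E':|\chi(x)|\le 1\ \forall x\in U\}$ of some neighborhood $U$ of zero in $E$. $E$ is $c_0$-quasibarrelled if every $\beta(E',E)$-null sequence in $E'$ is equicontinuous. A fundamental bounded sequence in $E$ is an increasing sequence $(B_n)_{n\in\mathbb{N}}$ of bounded subsets of $E$ such that every bounded subset of $E$ is contained in some $B_n$. $E$ is a $(df)$-space if it has a fundamental bounded sequence and is $c_0$-quasibarrelled. The set $\mathbb{N}^{\mathbb{N}}$ is ordered pointwise. A fundamental bounded resolution in $E$ is a family $\{B_\alpha\}_{\alpha\in\mathbb{N}^{\mathbb{N}}}$ of bounded subsets of $E$ such that $B_\alpha\subseteq B_\beta$ whenever $\alpha\le\beta$, and every bounded subset of $E$ is contained in some $B_\alpha$. $E$ belongs to the class $\mathfrak{G}$ (of Cascales and Orihuela) if there is a family $\{A_\alpha\}_{\alpha\in\mathbb{N}^{\mathbb{N}}}$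 of subsets of $E'$ such that $E'=\bigcup_\alpha A_\alpha$, $A_\alpha\subseteq A_\beta$ whenever $\alpha\le\beta$, and every sequence contained in a single $A_\alpha$ is equicontinuous. $E$ is a quasi-$(DF)$-space if it admits a fundamental bounded resolution and belongs to the class $\mathfrak{G}$. *)

theory Defs
  imports "HOL-Analysis.Analysis" "HOL-Analysis.Finite_Function_Topology"
begin

section \<open>Locally convex spaces\<close>

text \<open>A locally convex space is a topology whose underlying set is a linear subspace of some
  ambient real vector space type.  Working with carriers instead of whole types makes it possible
  to quantify over all locally convex spaces living on a given type.\<close>

definition lcs :: "'a::real_vector topology \<Rightarrow> bool" where
  "lcs E \<longleftrightarrow>
     subspace (topspace E) \<and>
     Hausdorff_space E \<and>
     continuous_map (prod_topology E E) E (\<lambda>(x, y). x + y) \<and>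
     continuous_map (prod_topology euclideanreal E) E (\<lambda>(c, x). c *\<^sub>R x) \<and>
     (\<forall>U. openin E U \<and> 0 \<in> U \<longrightarrow> (\<exists>V. openin E V \<and> 0 \<in> V \<and> convex V \<and> V \<subseteq> U))"

definition linear_map_on :: "'a::real_vector set \<Rightarrow> ('a \<Rightarrow> 'b::real_vector) \<Rightarrow> bool" where
  "linear_map_on S g \<longleftrightarrow>
     (\<forall>x\<in>S. \<forall>y\<in>S. g (x + y) = g x + g y) \<and> (\<forall>c. \<forall>x\<in>S. g (c *\<^sub>R x) = c *\<^sub>R g x)"

text \<open>Operators are made extensional, i.e. equal to \<^const>\<open>undefined\<close> outside of the carrier, so that
  equality of operators is equality of functions.\<close>

definition operators :: "'a::real_vector topology \<Rightarrow> 'b::real_vector topology \<Rightarrow> ('a \<Rightarrow> 'b) set" where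
  "operators L E =
     {g \<in> extensional (topspace L). continuous_map L E g \<and> linear_map_on (topspace L) g}"

definition dual :: "'a::real_vector topology \<Rightarrow> ('a \<Rightarrow> real) set" where
  "dual E = operators E euclideanreal"

definition lcs_bounded :: "'a::real_vector topology \<Rightarrow> 'a set \<Rightarrow> bool" where
  "lcs_bounded E B \<longleftrightarrow>
     B \<subseteq> topspace E \<and> (\<forall>U. openin E U \<and> 0 \<in> U \<longrightarrow> (\<exists>r>0. B \<subseteq> (\<lambda>x. r *\<^sub>R x) ` U))"

definition polar :: "'a::real_vector topology \<Rightarrow> 'a set \<Rightarrow> ('a \<Rightarrow> real) set" where
  "polar E U = {\<phi> \<in> dual E. \<forall>x\<in>U. \<bar>\<phi> x\<bar> \<le> 1}"

text \<open>Polars are antitone, so it suffices to consider open neighbourhoods of zero.\<close>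

definition equicontinuous :: "'a::real_vector topology \<Rightarrow> ('a \<Rightarrow> real) set \<Rightarrow> bool" where
  "equicontinuous E A \<longleftrightarrow> (\<exists>U. openin E U \<and> 0 \<in> U \<and> A \<subseteq> polar E U)"


section \<open>The strong dual\<close>

definition strong_dual :: "'a::real_vector topology \<Rightarrow> ('a \<Rightarrow> real) topology" where
  "strong_dual E = topology (\<lambda>W. W \<subseteq> dual E \<and>
     (\<forall>\<phi>\<in>W. \<exists>B e. lcs_bounded E B \<and> e > 0 \<and>
        {\<psi> \<in> dual E. \<forall>x\<in>B. \<bar>\<psi> x - \<phi> x\<bar> < e} \<subseteq> W))"

definition zero_functional :: "'a::real_vector topology \<Rightarrow> 'a \<Rightarrow> real" where
  "zero_functional E = restrict (\<lambda>_. 0) (topspace E)"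

definition c0_quasibarrelled :: "'a::real_vector topology \<Rightarrow> bool" where
  "c0_quasibarrelled E \<longleftrightarrow>
     (\<forall>\<phi>::nat \<Rightarrow> 'a \<Rightarrow> real. range \<phi> \<subseteq> dual E \<and>
        limitin (strong_dual E) \<phi> (zero_functional E) sequentially
        \<longrightarrow> equicontinuous E (range \<phi>))"


section \<open>(df)-spaces and quasi-(DF)-spaces\<close>

definition fundamental_bounded_sequence :: "'a::real_vector topology \<Rightarrow> (nat \<Rightarrow> 'a set) \<Rightarrow> bool" where
  "fundamental_bounded_sequence E B \<longleftrightarrow>
     mono B \<and> (\<forall>n. lcs_bounded E (B n)) \<and>
     (\<forall>C. lcs_bounded E C \<longrightarrow> (\<exists>n. C \<subseteq> B n))"

definition df_space :: "'a::real_vector topology \<Rightarrow> bool" where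
  "df_space E \<longleftrightarrow>
     lcs E \<and> (\<exists>B. fundamental_bounded_sequence E B) \<and> c0_quasibarrelled E"

text \<open>Below, \<^const>\<open>mono\<close> refers to the pointwise order on \<^typ>\<open>nat \<Rightarrow> nat\<close>.\<close>

definition fundamental_bounded_resolution ::
    "'a::real_vector topology \<Rightarrow> ((nat \<Rightarrow> nat) \<Rightarrow> 'a set) \<Rightarrow> bool" where
  "fundamental_bounded_resolution E B \<longleftrightarrow>
     mono B \<and> (\<forall>\<alpha>. lcs_bounded E (B \<alpha>)) \<and>
     (\<forall>C. lcs_bounded E C \<longrightarrow> (\<exists>\<alpha>. C \<subseteq> B \<alpha>))"

definition class_G :: "'a::real_vector topology \<Rightarrow> bool" where
  "class_G E \<longleftrightarrow>
     lcs E \<and>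
     (\<exists>A::(nat \<Rightarrow> nat) \<Rightarrow> ('a \<Rightarrow> real) set.
        dual E = (\<Union>\<alpha>. A \<alpha>) \<and> mono A \<and>
        (\<forall>\<alpha>. \<forall>\<phi>::nat \<Rightarrow> 'a \<Rightarrow> real. range \<phi> \<subseteq> A \<alpha> \<longrightarrow> equicontinuous E (range \<phi>)))"

definition quasi_DF_space :: "'a::real_vector topology \<Rightarrow> bool" where
  "quasi_DF_space E \<longleftrightarrow>
     lcs E \<and> (\<exists>B. fundamental_bounded_resolution E B) \<and> class_G E"


section \<open>Free locally convex spaces\<close>

definition extends_uniquely ::
    "'k topology \<Rightarrow> 'v::real_vector topology \<Rightarrow> ('k \<Rightarrow> 'v) \<Rightarrow> 'w::real_vector topology \<Rightarrow> bool" where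
  "extends_uniquely X L i E \<longleftrightarrow>
     (\<forall>f. continuous_map X E f \<longrightarrow>
        (\<exists>!g. g \<in> operators L E \<and> (\<forall>x\<in>topspace X. f x = g (i x))))"

text \<open>The universal property ranges over the locally convex spaces of every type, which no
  single formula can express.  The definition asks for it on two types: the ambient type of \<open>L\<close>
  and the type of finitely supported functions on \<open>X\<close>.  The theorem \<open>free_lcs_universal\<close> below
  shows that it then holds for the locally convex spaces of every type.\<close>

definition free_lcs :: "'k topology \<Rightarrow> 'v::real_vector topology \<Rightarrow> ('k \<Rightarrow> 'v) \<Rightarrow> bool" where
  "free_lcs X L i \<longleftrightarrow>
     lcs L \<and> continuous_map X L i \<and>
     (\<forall>E::'v topology. lcs E \<longrightarrow> extends_uniquely X L i E) \<and>
     (\<forall>E::('k \<Rightarrow>\<^sub>0 real) topology. lcs E \<longrightarrow> extends_uniquely X L i E)"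


section \<open>Adequacy of the definitions\<close>

lemma lcs_bounded_Un:
  assumes E: "lcs E" and B: "lcs_bounded E B" and C: "lcs_bounded E C"
  shows "lcs_bounded E (B \<union> C)"
  unfolding lcs_bounded_def
proof (intro conjI allI impI)
  show "B \<union> C \<subseteq> topspace E" using B C by (auto simp: lcs_bounded_def)
  fix U assume U: "openin E U \<and> 0 \<in> U"
  then obtain V where V: "openin E V" "0 \<in> V" "convex V" "V \<subseteq> U"
    using E unfolding lcs_def by meson
  have "\<exists>r>0. B \<subseteq> (\<lambda>x. r *\<^sub>R x) ` V" "\<exists>s>0. C \<subseteq> (\<lambda>x. s *\<^sub>R x) ` V"
    using B C V(1,2) by (simp_all add: lcs_bounded_def)
  then obtain r s where r: "r > 0" "B \<subseteq> (\<lambda>x. r *\<^sub>R x) ` V"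
    and s: "s > 0" "C \<subseteq> (\<lambda>x. s *\<^sub>R x) ` V"
    by (elim exE conjE)
  have grow: "t *\<^sub>R v \<in> (\<lambda>x. max r s *\<^sub>R x) ` U" if t: "0 < t" "t \<le> max r s" and v: "v \<in> V" for t v
  proof -
    have "(1 - t / max r s) *\<^sub>R 0 + (t / max r s) *\<^sub>R v \<in> V"
      using t v V r by (intro convexD[OF V(3)]) (auto simp: divide_simps)
    then have "(t / max r s) *\<^sub>R v \<in> U" using V(4) by auto
    moreover have "t *\<^sub>R v = max r s *\<^sub>R ((t / max r s) *\<^sub>R v)" using r by simp
    ultimately show ?thesis by blast
  qed
  have "B \<union> C \<subseteq> (\<lambda>x. max r s *\<^sub>R x) ` U"
  proof
    fix x assume "x \<in> B \<union> C"
    then consider v where "v \<in> V" "x = r *\<^sub>R v" | v where "v \<in> V" "x = s *\<^sub>R v"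
      using r(2) s(2) by blast
    then show "x \<in> (\<lambda>x. max r s *\<^sub>R x) ` U"
    proof cases
      case 1
      then show ?thesis using grow[of r v] r(1) by (simp del: image_iff)
    next
      case 2
      then show ?thesis using grow[of s v] s(1) by (simp del: image_iff)
    qed
  qed
  then show "\<exists>r>0. B \<union> C \<subseteq> (\<lambda>x. r *\<^sub>R x) ` U"
    using r(1) by (intro exI[of _ "max r s"] conjI) simp
qed

lemma lcs_bounded_empty: "lcs_bounded E {}"
  by (auto simp: lcs_bounded_def intro: exI[of _ 1])

lemma openin_strong_dual:
  assumes "lcs E"
  shows "openin (strong_dual E) W \<longleftrightarrow> W \<subseteq> dual E \<and>
     (\<forall>\<phi>\<in>W. \<exists>B e. lcs_bounded E B \<and> e > 0 \<and>
        {\<psi> \<in> dual E. \<forall>x\<in>B. \<bar>\<psi> x - \<phi> x\<bar> < e} \<subseteq> W)"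
proof -
  define P where "P = (\<lambda>W. W \<subseteq> dual E \<and>
     (\<forall>\<phi>\<in>W. \<exists>B e. lcs_bounded E B \<and> e > 0 \<and>
        {\<psi> \<in> dual E. \<forall>x\<in>B. \<bar>\<psi> x - \<phi> x\<bar> < e} \<subseteq> W))"
  have "istopology P"
    unfolding istopology_def
  proof (intro conjI allI impI)
    fix S T assume S: "P S" and T: "P T"
    show "P (S \<inter> T)"
      unfolding P_def
    proof (intro conjI ballI)
      show "S \<inter> T \<subseteq> dual E" using S by (auto simp: P_def)
      fix \<phi> assume "\<phi> \<in> S \<inter> T"
      then have "\<exists>B e. lcs_bounded E B \<and> e > 0 \<and>
            {\<psi> \<in> dual E. \<forall>x\<in>B. \<bar>\<psi> x - \<phi> x\<bar> < e} \<subseteq> S"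
          "\<exists>B e. lcs_bounded E B \<and> e > 0 \<and>
            {\<psi> \<in> dual E. \<forall>x\<in>B. \<bar>\<psi> x - \<phi> x\<bar> < e} \<subseteq> T"
        using S T by (simp_all add: P_def)
      then obtain B e C d where *: "lcs_bounded E B" "e > 0"
          "{\<psi> \<in> dual E. \<forall>x\<in>B. \<bar>\<psi> x - \<phi> x\<bar> < e} \<subseteq> S"
          "lcs_bounded E C" "d > 0" "{\<psi> \<in> dual E. \<forall>x\<in>C. \<bar>\<psi> x - \<phi> x\<bar> < d} \<subseteq> T"
        by (elim exE conjE)
      have "{\<psi> \<in> dual E. \<forall>x\<in>B \<union> C. \<bar>\<psi> x - \<phi> x\<bar> < min e d} \<subseteq> S \<inter> T"
        using *(3,6) by auto
      then show "\<exists>B e. lcs_bounded E B \<and> e > 0 \<and>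
          {\<psi> \<in> dual E. \<forall>x\<in>B. \<bar>\<psi> x - \<phi> x\<bar> < e} \<subseteq> S \<inter> T"
        using lcs_bounded_Un[OF assms *(1,4)] *(2,5)
        by (intro exI[of _ "B \<union> C"] exI[of _ "min e d"]) auto
    qed
  next
    fix K assume K: "\<forall>S\<in>K. P S"
    show "P (\<Union>K)"
      unfolding P_def
    proof (intro conjI ballI)
      show "\<Union>K \<subseteq> dual E" using K by (auto simp: P_def)
      fix \<phi> assume "\<phi> \<in> \<Union>K"
      then obtain S where S: "S \<in> K" "\<phi> \<in> S" by blast
      then obtain B e where "lcs_bounded E B" "e > 0"
          "{\<psi> \<in> dual E. \<forall>x\<in>B. \<bar>\<psi> x - \<phi> x\<bar> < e} \<subseteq> S"
        using K unfolding P_def by blast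
      then show "\<exists>B e. lcs_bounded E B \<and> e > 0 \<and>
          {\<psi> \<in> dual E. \<forall>x\<in>B. \<bar>\<psi> x - \<phi> x\<bar> < e} \<subseteq> \<Union>K"
        using S(1) by blast
    qed
  qed
  then have "openin (strong_dual E) = P"
    unfolding strong_dual_def P_def by (rule topology_inverse')
  then show ?thesis by (simp add: P_def)
qed

lemma topspace_strong_dual:
  assumes "lcs E"
  shows "topspace (strong_dual E) = dual E"
proof -
  have "openin (strong_dual E) (dual E)"
    unfolding openin_strong_dual[OF assms]
    by (auto intro!: exI[of _ "{}"] exI[of _ 1] lcs_bounded_empty)
  moreover have "topspace (strong_dual E) \<subseteq> dual E"
    using openin_strong_dual[OF assms] openin_topspace by blast
  ultimately show ?thesis by (meson openin_subset subset_antisym)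
qed

lemma limitin_strong_dual:
  assumes E: "lcs E" and \<phi>: "\<And>n. \<phi> n \<in> dual E" and l: "l \<in> dual E"
  shows "limitin (strong_dual E) \<phi> l sequentially \<longleftrightarrow>
     (\<forall>B. lcs_bounded E B \<longrightarrow> uniform_limit B \<phi> l sequentially)"
proof
  assume lim: "limitin (strong_dual E) \<phi> l sequentially"
  show "\<forall>B. lcs_bounded E B \<longrightarrow> uniform_limit B \<phi> l sequentially"
  proof (intro allI impI uniform_limitI)
    fix B and e :: real assume B: "lcs_bounded E B" and e: "e > 0"
    define W where "W = {\<theta> \<in> dual E. \<exists>d<e. \<forall>x\<in>B. \<bar>\<theta> x - l x\<bar> < d}"
    have "openin (strong_dual E) W"
      unfolding openin_strong_dual[OF E]
    proof (intro conjI ballI)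
      show "W \<subseteq> dual E" by (auto simp: W_def)
      fix \<theta> assume "\<theta> \<in> W"
      then obtain d where d: "d < e" "\<And>x. x \<in> B \<Longrightarrow> \<bar>\<theta> x - l x\<bar> < d" by (auto simp: W_def)
      have "\<psi> \<in> W" if \<psi>: "\<psi> \<in> dual E" "\<forall>x\<in>B. \<bar>\<psi> x - \<theta> x\<bar> < (e - d) / 2" for \<psi>
      proof -
        have "\<bar>\<psi> x - l x\<bar> < (e + d) / 2" if x: "x \<in> B" for x
        proof -
          have "\<bar>\<psi> x - \<theta> x\<bar> < (e - d) / 2" "\<bar>\<theta> x - l x\<bar> < d" using \<psi>(2) d(2) x by auto
          then show ?thesis by (simp add: field_simps abs_if split: if_splits)
        qed
        then show ?thesis using \<psi>(1) d(1) by (auto simp: W_def intro!: exI[of _ "(e + d) / 2"])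
      qed
      then show "\<exists>B e. lcs_bounded E B \<and> e > 0 \<and>
          {\<psi> \<in> dual E. \<forall>x\<in>B. \<bar>\<psi> x - \<theta> x\<bar> < e} \<subseteq> W"
        using B d(1) by (intro exI[of _ B] exI[of _ "(e - d) / 2"]) auto
    qed
    moreover have "l \<in> W" using l e by (auto simp: W_def intro!: exI[of _ "e / 2"])
    ultimately have "\<forall>\<^sub>F n in sequentially. \<phi> n \<in> W" using lim by (auto simp: limitin_def)
    then show "\<forall>\<^sub>F n in sequentially. \<forall>x\<in>B. dist (\<phi> n x) (l x) < e"
      by (rule eventually_mono) (force simp: W_def dist_real_def)
  qed
next
  assume lim: "\<forall>B. lcs_bounded E B \<longrightarrow> uniform_limit B \<phi> l sequentially"
  show "limitin (strong_dual E) \<phi> l sequentially"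
    unfolding limitin_def
  proof (intro conjI allI impI)
    show "l \<in> topspace (strong_dual E)" by (simp add: topspace_strong_dual E l)
    fix W assume W: "openin (strong_dual E) W \<and> l \<in> W"
    then obtain B e where B: "lcs_bounded E B" "e > 0"
        "{\<psi> \<in> dual E. \<forall>x\<in>B. \<bar>\<psi> x - l x\<bar> < e} \<subseteq> W"
      unfolding openin_strong_dual[OF E] by blast
    then have "\<forall>\<^sub>F n in sequentially. \<forall>x\<in>B. dist (\<phi> n x) (l x) < e"
      using lim by (auto dest: uniform_limitD)
    then show "\<forall>\<^sub>F n in sequentially. \<phi> n \<in> W"
      by (rule eventually_mono) (use B(3) \<phi> in \<open>auto simp: dist_real_def\<close>)
  qed
qed

lemma linear_map_on_0: "linear_map_on S g \<Longrightarrow> x \<in> S \<Longrightarrow> g 0 = 0"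
  unfolding linear_map_on_def by (metis scaleR_zero_left)

lemma lcs_pullback:
  assumes E: "lcs E" and S: "subspace S" and \<psi>: "linear_map_on S \<psi>" "inj_on \<psi> S"
    and into: "\<psi> ` S \<subseteq> topspace E"
  shows "lcs (pullback_topology S \<psi> E)"
proof -
  let ?P = "pullback_topology S \<psi> E"
  have top: "topspace ?P = S" using into by (auto simp: topspace_pullback_topology)
  have cont: "continuous_map ?P E \<psi>"
    using continuous_map_pullback[OF continuous_map_id, of S \<psi> E] by (simp add: o_def)
  have add: "continuous_map (prod_topology E E) E (\<lambda>(x, y). x + y)"
    and scale: "continuous_map (prod_topology euclideanreal E) E (\<lambda>(c, x). c *\<^sub>R x)"
    using E by (auto simp: lcs_def)
  have "Hausdorff_space ?P"
    using E Hausdorff_space_injective_preimage[OF _ cont] \<psi>(2) by (auto simp: lcs_def top)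
  moreover have "continuous_map (prod_topology ?P ?P) ?P (\<lambda>(x, y). x + y)"
  proof (rule continuous_map_pullback')
    have "continuous_map (prod_topology ?P ?P) (prod_topology E E) (\<lambda>z. (\<psi> (fst z), \<psi> (snd z)))"
      by (intro continuous_map_pairedI continuous_map_compose[OF continuous_map_fst cont, unfolded o_def]
          continuous_map_compose[OF continuous_map_snd cont, unfolded o_def])
    from continuous_map_compose[OF this add]
    have "continuous_map (prod_topology ?P ?P) E (\<lambda>z. \<psi> (fst z) + \<psi> (snd z))"
      by (simp add: o_def)
    then show "continuous_map (prod_topology ?P ?P) E (\<psi> \<circ> (\<lambda>(x, y). x + y))"
      by (rule continuous_map_eq) (use \<psi>(1) in \<open>auto simp: top linear_map_on_def\<close>)
    show "topspace (prod_topology ?P ?P) \<subseteq> (\<lambda>(x, y). x + y) -` S"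
      using S by (auto simp: top subspace_add)
  qed
  moreover have "continuous_map (prod_topology euclideanreal ?P) ?P (\<lambda>(c, x). c *\<^sub>R x)"
  proof (rule continuous_map_pullback')
    have "continuous_map (prod_topology euclideanreal ?P) (prod_topology euclideanreal E)
            (\<lambda>z. (fst z, \<psi> (snd z)))"
      by (intro continuous_map_pairedI continuous_map_fst
          continuous_map_compose[OF continuous_map_snd cont, unfolded o_def])
    from continuous_map_compose[OF this scale]
    have "continuous_map (prod_topology euclideanreal ?P) E (\<lambda>z. fst z *\<^sub>R \<psi> (snd z))"
      by (simp add: o_def)
    then show "continuous_map (prod_topology euclideanreal ?P) E (\<psi> \<circ> (\<lambda>(c, x). c *\<^sub>R x))"
      by (rule continuous_map_eq) (use \<psi>(1) in \<open>auto simp: top linear_map_on_def\<close>)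
    show "topspace (prod_topology euclideanreal ?P) \<subseteq> (\<lambda>(c, x). c *\<^sub>R x) -` S"
      using S by (auto simp: top subspace_scale)
  qed
  moreover have "\<exists>V. openin ?P V \<and> 0 \<in> V \<and> convex V \<and> V \<subseteq> U" if U: "openin ?P U" "0 \<in> U" for U
  proof -
    have 0: "\<psi> 0 = 0" using linear_map_on_0[OF \<psi>(1) subspace_0[OF S]] .
    obtain U' where U': "openin E U'" "U = \<psi> -` U' \<inter> S"
      using U(1) by (auto simp: openin_pullback_topology)
    then have "0 \<in> U'" using U(2) 0 by auto
    then obtain V where V: "openin E V" "0 \<in> V" "convex V" "V \<subseteq> U'"
      using E U'(1) unfolding lcs_def by blast
    have "convex (\<psi> -` V \<inter> S)"
    proof (rule convexI)
      fix x y and u v :: real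
      assume *: "x \<in> \<psi> -` V \<inter> S" "y \<in> \<psi> -` V \<inter> S" "0 \<le> u" "0 \<le> v" "u + v = 1"
      then have "\<psi> (u *\<^sub>R x + v *\<^sub>R y) = u *\<^sub>R \<psi> x + v *\<^sub>R \<psi> y"
        using \<psi>(1) S by (auto simp: linear_map_on_def subspace_scale)
      then show "u *\<^sub>R x + v *\<^sub>R y \<in> \<psi> -` V \<inter> S"
        using * V(3) S by (auto simp: convexD subspace_add subspace_scale)
    qed
    moreover have "openin ?P (\<psi> -` V \<inter> S)" using V(1) by (auto simp: openin_pullback_topology)
    ultimately show ?thesis
      using V 0 subspace_0[OF S] U'(2) by (intro exI[of _ "\<psi> -` V \<inter> S"]) auto
  qed
  ultimately show ?thesis using S unfolding lcs_def top by blast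
qed

lemma continuous_map_from_pullback:
  assumes "continuous_map Z (pullback_topology S \<psi> E) h"
  shows "continuous_map Z E (\<lambda>z. \<psi> (h z))"
proof -
  have "continuous_map (pullback_topology S \<psi> E) E \<psi>"
    using continuous_map_pullback[OF continuous_map_id, of S \<psi> E] by (simp add: o_def)
  from continuous_map_compose[OF assms this] show ?thesis by (simp add: o_def)
qed

lemma extends_uniquely_ex:
  assumes "extends_uniquely X L i E" "continuous_map X E f"
  shows "\<exists>g. g \<in> operators L E \<and> (\<forall>x\<in>topspace X. f x = g (i x))"
  by (rule ex1_implies_ex) (use assms in \<open>simp add: extends_uniquely_def\<close>)

lemma extends_uniquely_eq:
  assumes "extends_uniquely X L i E" "continuous_map X E f"
    and "g \<in> operators L E" "\<forall>x\<in>topspace X. f x = g (i x)"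
    and "h \<in> operators L E" "\<forall>x\<in>topspace X. f x = h (i x)"
  shows "g = h"
proof -
  have "\<exists>!g. g \<in> operators L E \<and> (\<forall>x\<in>topspace X. f x = g (i x))"
    using assms(1,2) by (simp add: extends_uniquely_def)
  then show ?thesis by (rule ex1E) (metis assms(3-6))
qed

lemma free_lcs_span:
  assumes "free_lcs X L i"
  shows "topspace L = span (i ` topspace X)"
proof
  have L: "lcs L" and i: "continuous_map X L i"
    and univ: "\<And>E::'b topology. lcs E \<Longrightarrow> extends_uniquely X L i E"
    using assms by (simp_all add: free_lcs_def)
  have sub: "subspace (topspace L)" using L by (simp add: lcs_def)
  have img: "i ` topspace X \<subseteq> topspace L" using i by (simp add: continuous_map_def Pi_iff image_subset_iff)
  then show M: "span (i ` topspace X) \<subseteq> topspace L" using sub by (simp add: span_minimal)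
  let ?M = "pullback_topology (span (i ` topspace X)) (\<lambda>x. x) L"
  have "lcs ?M"
    by (rule lcs_pullback[OF L]) (use M in \<open>auto simp: linear_map_on_def\<close>)
  moreover have "continuous_map X ?M i"
    by (rule continuous_map_pullback') (use i in \<open>simp_all add: o_def span_base subset_iff\<close>)
  ultimately obtain r where r: "r \<in> operators L ?M" "\<forall>x\<in>topspace X. i x = r (i x)"
    using extends_uniquely_ex[OF univ] by meson
  then have "r \<in> operators L L"
    using continuous_map_from_pullback[of L "span (i ` topspace X)" "\<lambda>x. x" L r]
    by (simp add: operators_def)
  moreover have "restrict (\<lambda>x. x) (topspace L) \<in> operators L L"
    using sub continuous_map_eq[OF continuous_map_id, of L "restrict (\<lambda>x. x) (topspace L)"]
    by (simp add: operators_def linear_map_on_def subspace_add subspace_scale)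
  moreover have "\<forall>x\<in>topspace X. i x = restrict (\<lambda>x. x) (topspace L) (i x)"
    using img by auto
  ultimately have eq: "r = restrict (\<lambda>x. x) (topspace L)"
    using extends_uniquely_eq[OF univ[OF L] i] r(2) by simp
  show "topspace L \<subseteq> span (i ` topspace X)"
  proof
    fix x assume x: "x \<in> topspace L"
    have "continuous_map L ?M r" using r(1) by (simp add: operators_def)
    then have "r x \<in> topspace ?M" using x by (simp add: continuous_map_def Pi_iff)
    then show "x \<in> span (i ` topspace X)" using eq x by (simp add: topspace_pullback_topology)
  qed
qed

lemma lookup_scaleR: "Poly_Mapping.lookup (c *\<^sub>R p) k = c *\<^sub>R Poly_Mapping.lookup p k"
proof -
  have "finite {k. c *\<^sub>R Poly_Mapping.lookup p k \<noteq> 0}"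
    by (rule finite_subset[OF _ finite_lookup[of p]]) auto
  then show ?thesis
    by (simp add: scaleR_poly_mapping_def Abs_poly_mapping_inverse)
qed

theorem free_lcs_universal:
  fixes E :: "'w::real_vector topology"
  assumes free: "free_lcs X L i" and E: "lcs E"
  shows "extends_uniquely X L i E"
  unfolding extends_uniquely_def
proof (intro allI impI)
  fix f assume f: "continuous_map X E f"
  have subL: "subspace (topspace L)" and subE: "subspace (topspace E)"
    using free E by (simp_all add: free_lcs_def lcs_def)
  have fE: "f x \<in> topspace E" if "x \<in> topspace X" for x
    using f that by (simp add: continuous_map_def Pi_iff)
  have iL: "i x \<in> topspace L" if "x \<in> topspace X" for x
    using free that by (simp add: free_lcs_def continuous_map_def Pi_iff)
  define f' where "f' = (\<lambda>x. if x \<in> topspace X then f x else 0)"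
  define \<Psi> :: "('a \<Rightarrow>\<^sub>0 real) \<Rightarrow> 'w" where
    "\<Psi> = (\<lambda>p. \<Sum>k\<in>Poly_Mapping.keys p. Poly_Mapping.lookup p k *\<^sub>R f' k)"
  have \<Psi>_eq: "\<Psi> p = (\<Sum>k\<in>K. Poly_Mapping.lookup p k *\<^sub>R f' k)"
    if "finite K" "Poly_Mapping.keys p \<subseteq> K" for p K
    unfolding \<Psi>_def using that
    by (intro sum.mono_neutral_left) (auto simp: in_keys_iff)
  have lin: "linear \<Psi>"
  proof (rule linearI)
    fix p q :: "'a \<Rightarrow>\<^sub>0 real"
    let ?K = "Poly_Mapping.keys p \<union> Poly_Mapping.keys q"
    show "\<Psi> (p + q) = \<Psi> p + \<Psi> q"
      using \<Psi>_eq[of ?K p] \<Psi>_eq[of ?K q] \<Psi>_eq[of ?K "p + q"] Poly_Mapping.keys_add[of p q]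
      by (simp add: lookup_add scaleR_left_distrib sum.distrib)
  next
    fix c :: real and p :: "'a \<Rightarrow>\<^sub>0 real"
    have "Poly_Mapping.keys (c *\<^sub>R p) \<subseteq> Poly_Mapping.keys p"
      by (auto simp: in_keys_iff lookup_scaleR)
    then show "\<Psi> (c *\<^sub>R p) = c *\<^sub>R \<Psi> p"
      using \<Psi>_eq[of "Poly_Mapping.keys p" p] \<Psi>_eq[of "Poly_Mapping.keys p" "c *\<^sub>R p"]
      by (simp add: scaleR_sum_right lookup_scaleR)
  qed
  have \<Psi>_single: "\<Psi> (Poly_Mapping.single k 1) = f' k" for k
    by (simp add: \<Psi>_def)
  have \<Psi>_E: "\<Psi> p \<in> topspace E" for p
    unfolding \<Psi>_def f'_def
    by (intro subspace_sum[OF subE] subspace_scale[OF subE]) (auto simp: fE subspace_0[OF subE])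
  obtain G where G: "linear G" "\<And>y. y \<in> range \<Psi> \<Longrightarrow> \<Psi> (G y) = y"
    using linear_exists_right_inverse_on[OF lin subspace_UNIV] by blast
  define S where "S = G ` range \<Psi>"
  have S: "subspace S"
    unfolding S_def by (intro linear_subspace_image G lin subspace_UNIV)
  let ?P = "pullback_topology S \<Psi> E"
  have "lcs ?P"
  proof (rule lcs_pullback[OF E S])
    show "linear_map_on S \<Psi>" using lin by (auto simp: linear_map_on_def linear_add linear_scale)
    show "inj_on \<Psi> S" unfolding S_def by (rule inj_onI) (use G(2) in auto)
    show "\<Psi> ` S \<subseteq> topspace E" using \<Psi>_E by auto
  qed
  then have univ: "extends_uniquely X L i ?P" using free by (simp add: free_lcs_def)
  have inv: "\<Psi> (G (f x)) = f x" "G (f x) \<in> S" if "x \<in> topspace X" for x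
  proof -
    have "f x \<in> range \<Psi>" using \<Psi>_single[of x] that by (metis f'_def rangeI)
    then show "\<Psi> (G (f x)) = f x" "G (f x) \<in> S" using G(2) by (auto simp: S_def)
  qed
  have "continuous_map X ?P (\<lambda>x. G (f x))"
  proof (rule continuous_map_pullback')
    show "continuous_map X E (\<Psi> \<circ> (\<lambda>x. G (f x)))"
      by (rule continuous_map_eq[OF f]) (simp add: inv)
    show "topspace X \<subseteq> (\<lambda>x. G (f x)) -` S" using inv by auto
  qed
  then obtain h where h: "h \<in> operators L ?P" "\<And>x. x \<in> topspace X \<Longrightarrow> G (f x) = h (i x)"
    using extends_uniquely_ex[OF univ] by meson
  let ?g = "restrict (\<lambda>v. \<Psi> (h v)) (topspace L)"
  have "continuous_map L E (\<lambda>v. \<Psi> (h v))"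
    using h(1) continuous_map_from_pullback[of L S \<Psi> E h] by (simp add: operators_def)
  then have "?g \<in> operators L E"
    using h(1) lin subL continuous_map_eq[of L E "\<lambda>v. \<Psi> (h v)" ?g]
    by (simp add: operators_def linear_map_on_def subspace_add subspace_scale
        linear_add linear_scale)
  moreover have "\<forall>x\<in>topspace X. f x = ?g (i x)"
    using h(2) inv iL by force
  moreover have "g1 = g2"
    if g1: "g1 \<in> operators L E" "\<forall>x\<in>topspace X. f x = g1 (i x)"
      and g2: "g2 \<in> operators L E" "\<forall>x\<in>topspace X. f x = g2 (i x)" for g1 g2
  proof -
    have lin12: "linear_map_on (topspace L) g1" "linear_map_on (topspace L) g2"
      using g1 g2 by (auto simp: operators_def)
    have "subspace {v \<in> topspace L. g1 v = g2 v}"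
      using lin12 subL linear_map_on_0[OF lin12(1)] linear_map_on_0[OF lin12(2)] subspace_0[OF subL]
      by (auto simp: subspace_def linear_map_on_def)
    then have "span (i ` topspace X) \<subseteq> {v \<in> topspace L. g1 v = g2 v}"
      by (rule span_minimal[rotated]) (use g1 g2 iL in auto)
    then have "g1 v = g2 v" if "v \<in> topspace L" for v
      using that free_lcs_span[OF free] by auto
    then show "g1 = g2"
      using g1 g2 by (intro extensionalityI[of _ "topspace L"]) (auto simp: operators_def)
  qed
  ultimately show "\<exists>!g. g \<in> operators L E \<and> (\<forall>x\<in>topspace X. f x = g (i x))"
    by blast
qed

end

theory Submission
  imports Defs
begin

text \<open>
  The functionals on the free space \<open>L\<close> over a compact Hausdorff space \<open>K\<close> are the continuous
  functions on \<open>K\<close>: a functional \<open>\<phi>\<close> corresponds to \<open>\<phi> \<circ> i\<close>.  Both halves of the theorem translate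
  equicontinuity of functionals on \<open>L\<close> into properties of functions on \<open>K\<close>.

  Positive half.  If functionals \<open>\<phi>\<^sub>n\<close> converge to zero uniformly on \<open>i K\<close>, then
  \<open>x \<mapsto> (\<phi>\<^sub>n (i x))\<^sub>n\<close> is a continuous map from \<open>K\<close> into a Banach space of bounded sequences.  It
  extends to a continuous operator on \<open>L\<close>, whose coordinates are the \<open>\<phi>\<^sub>n\<close>, so that the \<open>\<phi>\<^sub>n\<close> are
  equicontinuous (\<open>free_lcs_uniformly_null_equicontinuous\<close>).  This single fact is used twice.
  Strongly null sequences are uniformly null on the bounded set \<open>i K\<close>, so \<open>L\<close> is
  \<open>c\<^sub>0\<close>-quasibarrelled.  And every bounded set \<open>C\<close> lies in a multiple of the absolutely convex hull
  of \<open>i K\<close>: otherwise some \<open>v\<^sub>n \<in> C\<close> and functionals \<open>\<phi>\<^sub>n\<close> bounded by one on \<open>i K\<close> satisfy \<open>\<phi>\<^sub>n v\<^sub>n > 4\<^sup>n\<close>,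
  while the \<open>\<phi>\<^sub>n / 2\<^sup>n\<close> are uniformly null, hence equicontinuous, hence uniformly bounded on \<open>C\<close>.
  This takes the place of the uniform boundedness principle for the Banach space of continuous
  functions on \<open>K\<close>.  Since these multiples are themselves bounded, \<open>K\<close> being compact, they form a
  fundamental bounded sequence.

  Negative half.  Suppose that \<open>L\<close> is in the class G, with a family \<open>(A\<^sub>\<alpha>)\<close> of sets of functionals.
  An equicontinuous sequence of functionals restricts to a bounded equicontinuous sequence of functions
  on \<open>K\<close>, so by the Arzela--Ascoli argument it is not \<open>\<epsilon>\<close>-separated in the supremum norm
  (\<open>equicontinuous_sequence_not_separated\<close>).  A maximal \<open>\<epsilon>\<close>-separated set \<open>S\<close> of continuous
  functions thus meets every \<open>A\<^sub>\<alpha>\<close> in a finite set, and a set covered by a monotone family of finite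
  sets indexed by \<open>\<nat>\<^sup>\<nat>\<close> is countable (\<open>finite_resolution_countable\<close>).  By maximality \<open>S\<close>
  approximates every continuous function up to \<open>\<epsilon> = 1 / 4\<close>, so it separates the points of \<open>K\<close>, and a
  compact space with countably many continuous functions separating its points is metrizable.
\<close>

section \<open>Bounded sets in locally convex spaces\<close>

lemma continuous_map_lcs_add:
  assumes "lcs E" "continuous_map X E f" "continuous_map X E g"
  shows "continuous_map X E (\<lambda>x. f x + g x)"
proof -
  have 1: "continuous_map X (prod_topology E E) (\<lambda>x. (f x, g x))"
    using assms(2,3) by (simp add: continuous_map_pairedI)
  have 2: "continuous_map (prod_topology E E) E (\<lambda>(x, y). x + y)"
    using assms(1) by (simp add: lcs_def)
  show ?thesis
    using continuous_map_compose[OF 1 2] by (simp add: o_def)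
qed

lemma continuous_map_lcs_scaleR:
  assumes "lcs E" "continuous_map X euclideanreal c" "continuous_map X E g"
  shows "continuous_map X E (\<lambda>x. c x *\<^sub>R g x)"
proof -
  have 1: "continuous_map X (prod_topology euclideanreal E) (\<lambda>x. (c x, g x))"
    using assms(2,3) by (simp add: continuous_map_pairedI)
  have 2: "continuous_map (prod_topology euclideanreal E) E (\<lambda>(c, x). c *\<^sub>R x)"
    using assms(1) by (simp add: lcs_def)
  show ?thesis
    using continuous_map_compose[OF 1 2] by (simp add: o_def)
qed

lemma lcs_euclidean: "lcs (euclidean :: 'a::real_normed_vector topology)"
  unfolding lcs_def
proof (intro conjI allI impI)
  show "continuous_map (prod_topology euclidean euclidean) euclidean (\<lambda>(x, y). x + y :: 'a)"
    by (auto simp: euclidean_product_topology case_prod_unfold intro!: continuous_intros)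
  show "continuous_map (prod_topology euclideanreal euclidean) euclidean (\<lambda>(c, x). c *\<^sub>R x :: 'a)"
    by (auto simp: euclidean_product_topology case_prod_unfold intro!: continuous_intros)
next
  fix U :: "'a set" assume "openin euclidean U \<and> 0 \<in> U"
  then obtain e where "e > 0" "ball 0 e \<subseteq> U" by (auto simp: open_contains_ball)
  then show "\<exists>V. openin euclidean V \<and> 0 \<in> V \<and> convex V \<and> V \<subseteq> U"
    by (intro exI[of _ "ball 0 e"]) auto
qed auto

lemma lcs_symmetric_convex_neighbourhood:
  assumes E: "lcs E" and U: "openin E U" "0 \<in> U"
  obtains V where "openin E V" "0 \<in> V" "convex V" "\<And>x. x \<in> V \<Longrightarrow> - x \<in> V" "V \<subseteq> U"
proof -
  obtain W where W: "openin E W" "0 \<in> W" "convex W" "W \<subseteq> U"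
    using E U unfolding lcs_def by meson
  have sub: "subspace (topspace E)" using E by (simp add: lcs_def)
  have "continuous_map E E (\<lambda>x. (- 1) *\<^sub>R x)"
    by (intro continuous_map_lcs_scaleR[OF E]) auto
  then have "openin E {x \<in> topspace E. (- 1) *\<^sub>R x \<in> W}"
    using W(1) by (rule openin_continuous_map_preimage)
  then have op: "openin E {x \<in> topspace E. - x \<in> W}" by simp
  let ?V = "W \<inter> {x \<in> topspace E. - x \<in> W}"
  have *: "{x \<in> topspace E. - x \<in> W} = uminus ` W"
  proof (intro equalityI subsetI)
    fix x assume "x \<in> {x \<in> topspace E. - x \<in> W}"
    then show "x \<in> uminus ` W" by (intro image_eqI[of _ _ "- x"]) auto
  next
    fix x assume "x \<in> uminus ` W"
    then show "x \<in> {x \<in> topspace E. - x \<in> W}"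
      using openin_subset[OF W(1)] sub by (auto simp: subspace_neg)
  qed
  have "convex ?V"
    unfolding * by (intro convex_Int W(3) convex_negations)
  moreover have "openin E ?V" using W(1) op by blast
  ultimately show ?thesis
    using W sub that[of ?V] openin_subset[OF W(1)] by (auto simp: subspace_0)
qed

lemma absolutely_convex_sum:
  fixes w :: "'b \<Rightarrow> 'a::real_vector"
  assumes V: "convex V" "0 \<in> V" "\<And>x. x \<in> V \<Longrightarrow> - x \<in> V"
    and F: "finite F" "\<And>a. a \<in> F \<Longrightarrow> w a \<in> V" and d: "(\<Sum>a\<in>F. \<bar>d a\<bar>) \<le> 1"
  shows "(\<Sum>a\<in>F. d a *\<^sub>R w a) \<in> V"
proof -
  define t where "t = (\<Sum>a\<in>F. \<bar>d a\<bar>)"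
  show ?thesis
  proof (cases "t = 0")
    case True
    then have "\<forall>a\<in>F. d a = 0" using F(1) by (simp add: t_def sum_nonneg_eq_0_iff)
    then show ?thesis using V(2) by simp
  next
    case False
    then have t: "t > 0" by (simp add: t_def sum_nonneg order_less_le)
    have "(\<Sum>a\<in>F. (\<bar>d a\<bar> / t) *\<^sub>R (sgn (d a) *\<^sub>R w a)) \<in> V"
    proof (rule convex_sum[OF F(1) V(1)])
      show "(\<Sum>a\<in>F. \<bar>d a\<bar> / t) = 1"
        using t by (simp add: t_def flip: sum_divide_distrib)
      show "sgn (d a) *\<^sub>R w a \<in> V" if "a \<in> F" for a
        using F(2)[OF that] V by (auto simp: sgn_if)
    qed (use t in auto)
    then have "t *\<^sub>R (\<Sum>a\<in>F. (\<bar>d a\<bar> / t) *\<^sub>R (sgn (d a) *\<^sub>R w a)) + (1 - t) *\<^sub>R 0 \<in> V"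
      using t d V by (intro convexD[OF V(1)]) (auto simp: t_def)
    moreover have "t *\<^sub>R (\<Sum>a\<in>F. (\<bar>d a\<bar> / t) *\<^sub>R (sgn (d a) *\<^sub>R w a)) = (\<Sum>a\<in>F. d a *\<^sub>R w a)"
      using t by (simp add: scaleR_sum_right abs_mult_sgn)
    ultimately show ?thesis by simp
  qed
qed

text \<open>The sets \<open>n V\<close> form an increasing open cover of the space, since \<open>x / n\<close> tends to zero for
  every \<open>x\<close>; compactness selects one of them.\<close>

lemma compactin_absorbed:
  assumes E: "lcs E" and C: "compactin E C" and V: "openin E V" "0 \<in> V" "convex V"
  shows "\<exists>r>0. C \<subseteq> (\<lambda>x. r *\<^sub>R x) ` V"
proof -
  define W where "W = (\<lambda>n::nat. {x \<in> topspace E. (1 / real (Suc n)) *\<^sub>R x \<in> V})"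
  have CE: "C \<subseteq> topspace E" using C by (simp add: compactin_subset_topspace)
  have "continuous_map E E (\<lambda>x. (1 / real (Suc n)) *\<^sub>R x)" for n
    by (intro continuous_map_lcs_scaleR[OF E]) auto
  then have Wop: "openin E (W n)" for n
    unfolding W_def by (rule openin_continuous_map_preimage[OF _ V(1)])
  have cover: "\<exists>n. x \<in> W n" if x: "x \<in> C" for x
  proof -
    have "continuous_map euclideanreal E (\<lambda>c. c *\<^sub>R x)"
      using x CE by (intro continuous_map_lcs_scaleR[OF E]) auto
    from openin_continuous_map_preimage[OF this V(1)]
    have "open {c. c *\<^sub>R x \<in> V}" by simp
    then obtain e where e: "e > 0" "ball 0 e \<subseteq> {c. c *\<^sub>R x \<in> V}"
      using V(2) by (metis (no_types, lifting) mem_Collect_eq open_contains_ball scaleR_zero_left)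
    obtain n where "inverse (real (Suc n)) < e" using reals_Archimedean[OF e(1)] by blast
    then have "1 / real (Suc n) \<in> ball 0 e" by (simp add: inverse_eq_divide)
    then show ?thesis using e(2) x CE unfolding W_def by blast
  qed
  have mono: "W m \<subseteq> W n" if "m \<le> n" for m n
  proof
    fix x assume x: "x \<in> W m"
    define s where "s = real (Suc m) / real (Suc n)"
    have s: "0 \<le> s" "s \<le> 1" using that by (auto simp: s_def)
    have "s *\<^sub>R ((1 / real (Suc m)) *\<^sub>R x) + (1 - s) *\<^sub>R 0 \<in> V"
      using x V(2) s by (intro convexD[OF V(3)]) (auto simp: W_def)
    moreover have "s * (1 / real (Suc m)) = 1 / real (Suc n)" by (simp add: s_def)
    ultimately have "(1 / real (Suc n)) *\<^sub>R x \<in> V"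
      by (metis add.right_neutral scaleR_scaleR scaleR_zero_right)
    then show "x \<in> W n" using x by (simp add: W_def)
  qed
  have "\<exists>\<F>. finite \<F> \<and> \<F> \<subseteq> range W \<and> C \<subseteq> \<Union>\<F>"
    by (rule compactinD[OF C]) (use Wop cover in auto)
  then obtain I where I: "finite I" "C \<subseteq> (\<Union>n\<in>I. W n)"
    by (metis finite_subset_image)
  have "C \<subseteq> W (Max (insert 0 I))"
  proof
    fix x assume "x \<in> C"
    then obtain n where "n \<in> I" "x \<in> W n" using I(2) by blast
    moreover have "n \<le> Max (insert 0 I)" using I(1) \<open>n \<in> I\<close> by simp
    ultimately show "x \<in> W (Max (insert 0 I))" using mono by blast
  qed
  moreover have "W n \<subseteq> (\<lambda>x. real (Suc n) *\<^sub>R x) ` V" for n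
  proof
    fix x assume "x \<in> W n"
    then show "x \<in> (\<lambda>x. real (Suc n) *\<^sub>R x) ` V"
      by (intro image_eqI[of _ _ "(1 / real (Suc n)) *\<^sub>R x"])
        (simp_all add: W_def del: of_nat_Suc)
  qed
  ultimately show ?thesis
    by (intro exI[of _ "real (Suc (Max (insert 0 I)))"]) (auto simp del: of_nat_Suc)
qed

text \<open>For \<open>r \<ge> 0\<close> this is \<open>r\<close> times the absolutely convex hull of \<open>S\<close>.  For linearly independent \<open>S\<close>
  it is the ball of radius \<open>r\<close> of the \<open>\<ell>\<^sup>1\<close>-norm of the coordinates.\<close>

definition absco :: "'a::real_vector set \<Rightarrow> real \<Rightarrow> 'a set" where
  "absco S r = {\<Sum>a\<in>F. c a *\<^sub>R a | F c. finite F \<and> F \<subseteq> S \<and> (\<Sum>a\<in>F. \<bar>c a\<bar>) \<le> r}"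

lemma absco_mono: "r \<le> s \<Longrightarrow> absco S r \<subseteq> absco S s"
  unfolding absco_def by (smt (verit) Collect_mono)

lemma lcs_bounded_absco:
  assumes E: "lcs E" and C: "compactin E C"
  shows "lcs_bounded E (absco C r)"
  unfolding lcs_bounded_def
proof (intro conjI allI impI)
  have "subspace (topspace E)" using E by (simp add: lcs_def)
  then show "absco C r \<subseteq> topspace E"
    using compactin_subset_topspace[OF C]
    by (auto simp: absco_def intro!: subspace_sum subspace_scale)
  fix U assume U: "openin E U \<and> 0 \<in> U"
  obtain V where V: "openin E V" "0 \<in> V" "convex V" "\<And>x. x \<in> V \<Longrightarrow> - x \<in> V" "V \<subseteq> U"
    using lcs_symmetric_convex_neighbourhood[OF E] U by blast
  obtain \<rho> where \<rho>: "\<rho> > 0" "C \<subseteq> (\<lambda>x. \<rho> *\<^sub>R x) ` V"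
    using compactin_absorbed[OF E C V(1-3)] by blast
  define m where "m = max 1 r"
  have m: "m > 0" "r \<le> m" by (auto simp: m_def)
  have "absco C r \<subseteq> (\<lambda>x. (m * \<rho>) *\<^sub>R x) ` U"
  proof
    fix v assume "v \<in> absco C r"
    then obtain F c where F: "finite F" "F \<subseteq> C" "(\<Sum>a\<in>F. \<bar>c a\<bar>) \<le> r"
      and v: "v = (\<Sum>a\<in>F. c a *\<^sub>R a)" by (auto simp: absco_def)
    have "(\<Sum>a\<in>F. (c a / m) *\<^sub>R ((1 / \<rho>) *\<^sub>R a)) \<in> V"
    proof (rule absolutely_convex_sum[OF V(3,2,4) F(1)])
      show "(1 / \<rho>) *\<^sub>R a \<in> V" if "a \<in> F" for a using that F(2) \<rho> by auto
      have "(\<Sum>a\<in>F. \<bar>c a / m\<bar>) = (\<Sum>a\<in>F. \<bar>c a\<bar>) / m"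
        using m by (simp add: sum_divide_distrib)
      also have "\<dots> \<le> 1" using F(3) m by simp
      finally show "(\<Sum>a\<in>F. \<bar>c a / m\<bar>) \<le> 1" .
    qed
    moreover have "v = (m * \<rho>) *\<^sub>R (\<Sum>a\<in>F. (c a / m) *\<^sub>R ((1 / \<rho>) *\<^sub>R a))"
      using m \<rho> by (simp add: v scaleR_sum_right)
    ultimately show "v \<in> (\<lambda>x. (m * \<rho>) *\<^sub>R x) ` U" using V(5) by blast
  qed
  then show "\<exists>r'>0. absco C r \<subseteq> (\<lambda>x. r' *\<^sub>R x) ` U" using m \<rho> by (intro exI[of _ "m * \<rho>"]) auto
qed

lemma dual_add: "\<phi> \<in> dual E \<Longrightarrow> x \<in> topspace E \<Longrightarrow> y \<in> topspace E \<Longrightarrow> \<phi> (x + y) = \<phi> x + \<phi> y"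
  and dual_scaleR: "\<phi> \<in> dual E \<Longrightarrow> x \<in> topspace E \<Longrightarrow> \<phi> (c *\<^sub>R x) = c * \<phi> x"
  by (auto simp: dual_def operators_def linear_map_on_def)

lemma equicontinuous_imp_uniformly_bounded:
  assumes "equicontinuous E A" "lcs_bounded E B"
  shows "\<exists>r>0. \<forall>\<phi>\<in>A. \<forall>x\<in>B. \<bar>\<phi> x\<bar> \<le> r"
proof -
  obtain U where U: "openin E U" "0 \<in> U" "A \<subseteq> polar E U"
    using assms(1) by (auto simp: equicontinuous_def)
  obtain r where r: "r > 0" "B \<subseteq> (\<lambda>x. r *\<^sub>R x) ` U"
    using assms(2) U by (auto simp: lcs_bounded_def)
  have "\<bar>\<phi> x\<bar> \<le> r" if \<phi>: "\<phi> \<in> A" and x: "x \<in> B" for \<phi> x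
  proof -
    obtain u where u: "u \<in> U" "x = r *\<^sub>R u" using r(2) x by blast
    have p: "\<phi> \<in> dual E" "\<bar>\<phi> u\<bar> \<le> 1" using \<phi> U(3) u(1) by (auto simp: polar_def)
    have "u \<in> topspace E" using u(1) openin_subset[OF U(1)] by blast
    then have "\<phi> x = r * \<phi> u" by (simp add: u(2) dual_scaleR[OF p(1)])
    with p(2) show ?thesis using r(1) by (simp add: abs_mult mult_left_le)
  qed
  then show ?thesis using r(1) by blast
qed

section \<open>Continuous functions on the generating compact space\<close>

lemma dual_sum:
  assumes E: "lcs E" and \<phi>: "\<phi> \<in> dual E" and F: "finite F" "F \<subseteq> topspace E"
  shows "\<phi> (\<Sum>a\<in>F. c a *\<^sub>R a) = (\<Sum>a\<in>F. c a * \<phi> a)"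
  using F
proof (induction F)
  case empty
  have "0 \<in> topspace E" using E by (simp add: lcs_def subspace_0)
  then show ?case using dual_scaleR[OF \<phi>, of 0 0] by simp
next
  case (insert a F)
  have sub: "subspace (topspace E)" using E by (simp add: lcs_def)
  have "c a *\<^sub>R a \<in> topspace E" "(\<Sum>a\<in>F. c a *\<^sub>R a) \<in> topspace E"
    using insert.prems sub by (auto intro!: subspace_sum subspace_scale)
  then show ?case using insert by (simp add: dual_add[OF \<phi>] dual_scaleR[OF \<phi>])
qed

text \<open>The universal property with target the real line: every continuous function on \<open>K\<close> comes from a
  functional.\<close>

lemma free_lcs_dual_extension:
  assumes "free_lcs K L i" "continuous_map K euclideanreal f"
  obtains \<phi> where "\<phi> \<in> dual L" "\<And>x. x \<in> topspace K \<Longrightarrow> \<phi> (i x) = f x"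
proof -
  have "extends_uniquely K L i euclideanreal"
    by (rule free_lcs_universal[OF assms(1) lcs_euclidean])
  then show ?thesis using extends_uniquely_ex[OF _ assms(2)] that by (metis dual_def)
qed

lemma free_lcs_imp_lcs: "free_lcs K L i \<Longrightarrow> lcs L"
  by (simp add: free_lcs_def)

lemma free_lcs_generator: "free_lcs K L i \<Longrightarrow> x \<in> topspace K \<Longrightarrow> i x \<in> topspace L"
  by (simp add: free_lcs_def continuous_map_def Pi_iff)

text \<open>A finite subset of a T1 space is closed and discrete, so prescribed values on it form a
  continuous function to which Tietze's theorem applies.\<close>

lemma normal_T1_finite_interpolation:
  assumes X: "normal_space X" "t1_space X" and F: "finite F" "F \<subseteq> topspace X"
    and h: "\<And>x. x \<in> F \<Longrightarrow> \<bar>h x\<bar> \<le> (1::real)"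
  obtains f where "continuous_map X euclideanreal f" "\<And>x. x \<in> F \<Longrightarrow> f x = h x"
    "\<And>x. x \<in> topspace X \<Longrightarrow> \<bar>f x\<bar> \<le> 1"
proof -
  have "subtopology X F = discrete_topology (topspace X \<inter> F)"
    using subtopology_eq_discrete_topology_gen_finite[OF X(2) F(1)] .
  then have cont: "continuous_map (subtopology X F) euclideanreal h" by simp
  have clo: "closedin X F" using X(2) F by (simp add: t1_space_closedin_finite)
  have im: "h ` F \<subseteq> {- 1..1}" using h by (auto simp: abs_le_iff minus_le_iff)
  obtain g where g: "continuous_map X euclideanreal g" "g ` topspace X \<subseteq> {- 1..1}"
      "\<And>x. x \<in> F \<Longrightarrow> g x = h x"
    by (rule Tietze_extension_realinterval[OF X(1) clo is_interval_cc _ cont im]) auto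
  have "\<bar>g x\<bar> \<le> 1" if "x \<in> topspace X" for x
    using g(2) that by (simp add: image_subset_iff abs_le_iff minus_le_iff)
  then show ?thesis using that g by blast
qed

text \<open>The \<open>\<ell>\<^sup>1\<close>-norm of the coordinates of \<open>v\<close> is attained at the functional of a continuous function
  that takes at each of the finitely many points in the support of \<open>v\<close> the sign of its coefficient.\<close>

lemma free_lcs_norming_functional:
  assumes K: "normal_space K" "t1_space K" and free: "free_lcs K L i"
    and v: "v \<in> topspace L" "v \<notin> absco (i ` topspace K) r"
  obtains \<phi> where "\<phi> \<in> dual L" "\<And>x. x \<in> topspace K \<Longrightarrow> \<bar>\<phi> (i x)\<bar> \<le> 1" "\<phi> v > r"
proof -
  have "v \<in> span (i ` topspace K)" using v(1) free_lcs_span[OF free] by simp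
  then obtain F c where F: "finite F" "F \<subseteq> i ` topspace K" and vF: "v = (\<Sum>a\<in>F. c a *\<^sub>R a)"
    by (auto simp: span_explicit)
  have big: "(\<Sum>a\<in>F. \<bar>c a\<bar>) > r"
  proof (rule ccontr)
    assume "\<not> (\<Sum>a\<in>F. \<bar>c a\<bar>) > r"
    then have "v \<in> absco (i ` topspace K) r"
      unfolding absco_def vF using F by (intro CollectI exI[of _ F] exI[of _ c]) simp
    then show False using v(2) by blast
  qed
  \<comment> \<open>Choosing one point of \<open>K\<close> over each vector in the support makes the prescribed signs well defined.\<close>
  obtain G where G: "G \<subseteq> topspace K" "inj_on i G" "F = i ` G"
    using F(2) by (metis subset_image_inj)
  have "finite G" using F(1) G by (simp add: finite_image_iff)
  obtain f where f: "continuous_map K euclideanreal f" "\<And>x. x \<in> G \<Longrightarrow> f x = sgn (c (i x))"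
      "\<And>x. x \<in> topspace K \<Longrightarrow> \<bar>f x\<bar> \<le> 1"
    by (rule normal_T1_finite_interpolation[OF K \<open>finite G\<close> G(1), of "\<lambda>x. sgn (c (i x))"])
      (simp_all add: abs_sgn_eq)
  obtain \<phi> where \<phi>: "\<phi> \<in> dual L" "\<And>x. x \<in> topspace K \<Longrightarrow> \<phi> (i x) = f x"
    using free_lcs_dual_extension[OF free f(1)] by blast
  have "F \<subseteq> topspace L" using F(2) free_lcs_generator[OF free] by blast
  then have "\<phi> v = (\<Sum>a\<in>F. c a * \<phi> a)"
    unfolding vF using dual_sum[OF free_lcs_imp_lcs[OF free] \<phi>(1) F(1)] by blast
  also have "\<dots> = (\<Sum>a\<in>F. \<bar>c a\<bar>)"
  proof (rule sum.cong)
    fix a assume "a \<in> F"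
    then obtain x where "x \<in> G" "a = i x" using G(3) by blast
    then show "c a * \<phi> a = \<bar>c a\<bar>" using \<phi>(2) f(2) G(1) by (auto simp: abs_sgn)
  qed simp
  finally have "\<phi> v > r" using big by simp
  moreover have "\<bar>\<phi> (i x)\<bar> \<le> 1" if "x \<in> topspace K" for x using \<phi>(2) f(3) that by simp
  ultimately show ?thesis using that \<phi>(1) by blast
qed

section \<open>Equicontinuity in the dual of a free locally convex space\<close>

text \<open>The universal property with target a space of bounded sequences: the functionals become the
  coordinates of one continuous operator, and the preimage of the unit ball is the neighbourhood of zero
  required for equicontinuity.  Bounded continuous functions on the discrete space of natural numbers
  serve as bounded sequences.\<close>

lemma free_lcs_uniformly_null_equicontinuous:
  assumes free: "free_lcs K L i" and \<phi>: "\<And>n::nat. \<phi> n \<in> dual L"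
    and lim: "uniform_limit (i ` topspace K) \<phi> (\<lambda>_. 0) sequentially"
    and bdd: "\<And>n x. x \<in> topspace K \<Longrightarrow> \<bar>\<phi> n (i x)\<bar> \<le> c"
  shows "equicontinuous L (range \<phi>)"
proof -
  have L: "lcs L" and i: "continuous_map K L i" using free by (auto simp: free_lcs_def)
  have \<phi>i: "continuous_map K euclideanreal (\<lambda>x. \<phi> n (i x))" for n
    using continuous_map_compose[OF i, of euclideanreal "\<phi> n"] \<phi>[of n]
    by (simp add: dual_def operators_def o_def)
  define f :: "'a \<Rightarrow> nat \<Rightarrow>\<^sub>C real" where "f = (\<lambda>x. Bcontfun (\<lambda>n. \<phi> n (i x)))"
  have f: "apply_bcontfun (f x) n = \<phi> n (i x)" if "x \<in> topspace K" for x n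
  proof -
    have "(\<lambda>n. \<phi> n (i x)) \<in> bcontfun"
      by (rule bcontfun_normI[of _ c]) (use bdd that in auto)
    then show ?thesis by (simp add: f_def Bcontfun_inverse)
  qed
  \<comment> \<open>Near \<open>x\<close> the first \<open>N\<close> coordinates vary little by continuity; the others are small everywhere.\<close>
  have "\<exists>U. openin K U \<and> x \<in> U \<and> (\<forall>y\<in>U. f y \<in> ball (f x) e)"
    if x: "x \<in> topspace K" and e: "e > 0" for x e
  proof -
    have "\<forall>\<^sub>F n in sequentially. \<forall>v\<in>i ` topspace K. dist (\<phi> n v) 0 < e / 4"
      using uniform_limitD[OF lim, of "e / 4"] e by simp
    then obtain N where N: "\<And>n y. n \<ge> N \<Longrightarrow> y \<in> topspace K \<Longrightarrow> \<bar>\<phi> n (i y)\<bar> < e / 4"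
      by (auto simp: eventually_sequentially)
    define U where
      "U = topspace K \<inter> (\<Inter>n\<in>{..<N}. {y \<in> topspace K. \<phi> n (i y) \<in> ball (\<phi> n (i x)) (e / 2)})"
    have "openin K U"
      unfolding U_def
      by (intro openin_Int_Inter finite_imageI)
        (auto intro!: openin_continuous_map_preimage[OF \<phi>i] simp del: mem_ball)
    moreover have "x \<in> U" using x e by (simp add: U_def)
    moreover have "f y \<in> ball (f x) e" if y: "y \<in> U" for y
    proof -
      have yK: "y \<in> topspace K" using y by (simp add: U_def)
      have "dist (f x n) (f y n) \<le> e / 2" for n
      proof (cases "n < N")
        case True
        then have "dist (\<phi> n (i x)) (\<phi> n (i y)) < e / 2" using y by (simp add: U_def)
        then show ?thesis using x yK by (simp add: f)
      next
        case False
        then have "\<bar>\<phi> n (i x) - \<phi> n (i y)\<bar> \<le> e / 2"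
          using N[of n x] N[of n y] x yK abs_triangle_ineq4[of "\<phi> n (i x)" "\<phi> n (i y)"] by simp
        then show ?thesis using x yK by (simp add: f dist_real_def)
      qed
      then have "dist (f x) (f y) \<le> e / 2" by (rule dist_bound)
      then show ?thesis using e by simp
    qed
    ultimately show ?thesis by blast
  qed
  then have "continuous_map K euclidean f"
    using Met_TC.continuous_map_to_metric[of K f] by (simp del: mem_ball)
  then obtain T where T: "T \<in> operators L euclidean" "\<And>x. x \<in> topspace K \<Longrightarrow> f x = T (i x)"
    using extends_uniquely_ex[OF free_lcs_universal[OF free lcs_euclidean]] by blast
  define U where "U = {v \<in> topspace L. T v \<in> ball 0 1}"
  have linT: "linear_map_on (topspace L) T" using T(1) by (simp add: operators_def)
  have sub: "subspace (topspace L)" using L by (simp add: lcs_def)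
  have T0: "T 0 = 0" using linear_map_on_0[OF linT subspace_0[OF sub]] .
  have "openin L U"
    unfolding U_def using T(1)
    by (intro openin_continuous_map_preimage[of L euclidean T]) (auto simp: operators_def)
  moreover have "0 \<in> U" using T0 sub by (simp add: U_def subspace_0)
  \<comment> \<open>The two sides are linear in \<open>v\<close> and agree on the image of \<open>K\<close>, which spans \<open>L\<close>.\<close>
  moreover have coord: "\<phi> n v = T v n" if "v \<in> topspace L" for n v
  proof -
    have "subspace {v \<in> topspace L. \<phi> n v = T v n}"
      unfolding subspace_def
    proof (intro conjI ballI allI)
      show "0 \<in> {v \<in> topspace L. \<phi> n v = T v n}"
        using T0 sub dual_scaleR[OF \<phi>[of n], of 0 0] by (simp add: subspace_0)
    next
      fix u w assume "u \<in> {v \<in> topspace L. \<phi> n v = T v n}" "w \<in> {v \<in> topspace L. \<phi> n v = T v n}"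
      then show "u + w \<in> {v \<in> topspace L. \<phi> n v = T v n}"
        using linT sub dual_add[OF \<phi>[of n]]
        by (simp add: linear_map_on_def subspace_add plus_bcontfun.rep_eq)
    next
      fix c u assume "u \<in> {v \<in> topspace L. \<phi> n v = T v n}"
      then show "c *\<^sub>R u \<in> {v \<in> topspace L. \<phi> n v = T v n}"
        using linT sub dual_scaleR[OF \<phi>[of n]]
        by (simp add: linear_map_on_def subspace_scale scaleR_bcontfun.rep_eq)
    qed
    moreover have "i ` topspace K \<subseteq> {v \<in> topspace L. \<phi> n v = T v n}"
      using f T(2) free_lcs_generator[OF free] by force
    ultimately have "span (i ` topspace K) \<subseteq> {v \<in> topspace L. \<phi> n v = T v n}"
      by (rule span_minimal[rotated])
    then show ?thesis using that free_lcs_span[OF free] by blast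
  qed
  moreover have "\<bar>\<phi> n v\<bar> \<le> 1" if "v \<in> U" for n v
  proof -
    have v: "v \<in> topspace L" "norm (T v) < 1" using that by (auto simp: U_def)
    have "\<bar>T v n\<bar> \<le> norm (T v)" using norm_bounded[of "T v" n] by simp
    then show ?thesis using v coord by simp
  qed
  ultimately show ?thesis
    using \<phi> by (auto simp: equicontinuous_def polar_def)
qed

lemma compactin_free_lcs_generators:
  assumes "compact_space K" "free_lcs K L i"
  shows "compactin L (i ` topspace K)"
  using assms image_compactin[of K "topspace K" L i] by (simp add: compact_space_def free_lcs_def)

lemma free_lcs_generators_bounded:
  assumes K: "compact_space K" and free: "free_lcs K L i"
  shows "lcs_bounded L (i ` topspace K)"
proof -
  have "i ` topspace K \<subseteq> absco (i ` topspace K) 1"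
  proof
    fix a assume "a \<in> i ` topspace K"
    then show "a \<in> absco (i ` topspace K) 1"
      unfolding absco_def by (intro CollectI exI[of _ "{a}"] exI[of _ "\<lambda>_. 1"]) auto
  qed
  moreover have "lcs_bounded L (absco (i ` topspace K) 1)"
    using lcs_bounded_absco compactin_free_lcs_generators[OF K free] free_lcs_imp_lcs[OF free] by blast
  ultimately show ?thesis by (auto simp: lcs_bounded_def) (meson order_trans)
qed

lemma continuous_functional_bounded_on_generators:
  assumes K: "compact_space K" and free: "free_lcs K L i" and \<phi>: "\<phi> \<in> dual L"
  shows "\<exists>c. \<forall>x\<in>topspace K. \<bar>\<phi> (i x)\<bar> \<le> c"
proof -
  have "compactin euclideanreal (\<phi> ` i ` topspace K)"
    using image_compactin[OF compactin_free_lcs_generators[OF K free], of euclideanreal \<phi>] \<phi>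
    by (simp add: dual_def operators_def)
  then have "bounded (\<phi> ` i ` topspace K)" by (simp add: compact_imp_bounded)
  then show ?thesis by (auto simp: bounded_iff)
qed

section \<open>A fundamental bounded sequence and quasibarrelledness\<close>

text \<open>If \<open>C\<close> is in no multiple of the hull, there are \<open>v\<^sub>n \<in> C\<close> and functionals \<open>\<phi>\<^sub>n\<close> bounded by one on the
  image of \<open>K\<close> with \<open>\<phi>\<^sub>n v\<^sub>n > 4\<^sup>n\<close>.  Halving \<open>n\<close> times makes the functionals uniformly null and
  hence equicontinuous, but still leaves values larger than \<open>2\<^sup>n\<close> on \<open>C\<close>.\<close>

lemma free_lcs_bounded_subset_absco:
  assumes K: "compact_space K" "Hausdorff_space K" and free: "free_lcs K L i"
    and C: "lcs_bounded L C"
  shows "\<exists>n::nat. C \<subseteq> absco (i ` topspace K) (real n)"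
proof (rule ccontr)
  assume contra: "\<not> ?thesis"
  have CL: "C \<subseteq> topspace L" using C by (simp add: lcs_bounded_def)
  have K': "normal_space K" "t1_space K"
    using K by (simp_all add: compact_Hausdorff_or_regular_imp_normal_space Hausdorff_imp_t1_space)
  have "\<exists>v \<phi>. v \<in> C \<and> \<phi> \<in> dual L \<and> (\<forall>x\<in>topspace K. \<bar>\<phi> (i x)\<bar> \<le> 1) \<and> \<phi> v > 4 ^ n" for n
  proof -
    obtain v where v: "v \<in> C" "v \<notin> absco (i ` topspace K) (real (4 ^ n))"
      using contra by blast
    then have "v \<in> topspace L" using CL by blast
    from free_lcs_norming_functional[OF K' free this v(2)]
    obtain \<phi> where "\<phi> \<in> dual L" "\<And>x. x \<in> topspace K \<Longrightarrow> \<bar>\<phi> (i x)\<bar> \<le> 1" "\<phi> v > real (4 ^ n)"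
      by blast
    then show ?thesis using v(1) by (intro exI[of _ v] exI[of _ \<phi>]) simp
  qed
  then obtain v \<phi> where v: "\<And>n. v n \<in> C" and \<phi>: "\<And>n. \<phi> n \<in> dual L"
      "\<And>n x. x \<in> topspace K \<Longrightarrow> \<bar>\<phi> n (i x)\<bar> \<le> 1" and big: "\<And>n. \<phi> n (v n) > 4 ^ n"
    by metis
  define \<psi> where "\<psi> = (\<lambda>n. restrict (\<lambda>u. (1 / 2) ^ n * \<phi> n u) (topspace L))"
  have L: "lcs L" and sub: "subspace (topspace L)"
    using free_lcs_imp_lcs[OF free] by (auto simp: lcs_def)
  have \<psi>: "\<psi> n \<in> dual L" for n
  proof -
    have "continuous_map L euclideanreal (\<lambda>u. (1 / 2) ^ n * \<phi> n u)"
      using \<phi>(1)[of n] by (intro continuous_map_real_mult_left) (auto simp: dual_def operators_def)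
    then have "continuous_map L euclideanreal (\<psi> n)"
      by (rule continuous_map_eq) (simp add: \<psi>_def)
    moreover have "linear_map_on (topspace L) (\<psi> n)"
      using dual_add[OF \<phi>(1)[of n]] dual_scaleR[OF \<phi>(1)[of n]] sub
      by (simp add: \<psi>_def linear_map_on_def subspace_add subspace_scale algebra_simps)
    ultimately show ?thesis by (simp add: dual_def operators_def \<psi>_def)
  qed
  have small: "\<bar>\<psi> n (i x)\<bar> \<le> (1 / 2) ^ n" if "x \<in> topspace K" for n x
    using \<phi>(2)[OF that, of n] free_lcs_generator[OF free that]
    by (simp add: \<psi>_def abs_mult divide_simps)
  have "equicontinuous L (range \<psi>)"
  proof (rule free_lcs_uniformly_null_equicontinuous[OF free \<psi>])
    show "\<bar>\<psi> n (i x)\<bar> \<le> 1" if "x \<in> topspace K" for n x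
      using small[OF that, of n] power_le_one[of "1 / 2 :: real" n] by simp
    show "uniform_limit (i ` topspace K) \<psi> (\<lambda>_. 0) sequentially"
    proof (rule uniform_limitI)
      fix e :: real assume "e > 0"
      moreover have "(\<lambda>n. (1 / 2 :: real) ^ n) \<longlonglongrightarrow> 0" by (rule LIMSEQ_power_zero) simp
      ultimately have "\<forall>\<^sub>F n in sequentially. (1 / 2 :: real) ^ n < e"
        by (simp add: order_tendsto_iff)
      then show "\<forall>\<^sub>F n in sequentially. \<forall>u\<in>i ` topspace K. dist (\<psi> n u) 0 < e"
      proof eventually_elim
        case (elim n)
        have "\<bar>\<psi> n (i x)\<bar> < e" if "x \<in> topspace K" for x
          using small[OF that, of n] elim by linarith
        then show ?case by (simp add: dist_real_def)
      qed
    qed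
  qed
  from equicontinuous_imp_uniformly_bounded[OF this C]
  obtain r where "r > 0" and r: "\<forall>\<psi>'\<in>range \<psi>. \<forall>u\<in>C. \<bar>\<psi>' u\<bar> \<le> r"
    by (elim exE conjE)
  obtain n where n: "r < 2 ^ n" using real_arch_pow[of 2 r] by auto
  have "(1 / 2) ^ n * \<phi> n (v n) \<le> r"
  proof -
    have "\<bar>\<psi> n (v n)\<bar> \<le> r" using r v by blast
    moreover have "v n \<in> topspace L" using v CL by blast
    ultimately show ?thesis by (simp add: \<psi>_def abs_le_iff)
  qed
  moreover have "(1 / 2 :: real) ^ n * 4 ^ n = 2 ^ n"
    by (simp flip: power_mult_distrib)
  moreover have "(1 / 2 :: real) ^ n * 4 ^ n < (1 / 2) ^ n * \<phi> n (v n)"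
    using big[of n] by (intro mult_strict_left_mono) auto
  ultimately show False using n by simp
qed

lemma free_lcs_df_space:
  assumes K: "compact_space K" "Hausdorff_space K" and free: "free_lcs K L i"
  shows "df_space L"
  unfolding df_space_def
proof (intro conjI)
  show L: "lcs L" using free by (rule free_lcs_imp_lcs)
  have "fundamental_bounded_sequence L (\<lambda>n. absco (i ` topspace K) (real n))"
    unfolding fundamental_bounded_sequence_def
  proof (intro conjI allI impI)
    show "mono (\<lambda>n. absco (i ` topspace K) (real n))" by (intro monoI absco_mono) simp
  qed (simp_all add: lcs_bounded_absco L compactin_free_lcs_generators[OF K(1) free]
      free_lcs_bounded_subset_absco[OF K free])
  then show "\<exists>B. fundamental_bounded_sequence L B" by blast
  show "c0_quasibarrelled L"
    unfolding c0_quasibarrelled_def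
  proof (intro allI impI)
    fix \<phi> :: "nat \<Rightarrow> 'b \<Rightarrow> real"
    assume *: "range \<phi> \<subseteq> dual L \<and> limitin (strong_dual L) \<phi> (zero_functional L) sequentially"
    then have \<phi>: "\<phi> n \<in> dual L" for n by blast
    from * have "zero_functional L \<in> topspace (strong_dual L)" by (simp add: limitin_def)
    then have "zero_functional L \<in> dual L" by (simp add: topspace_strong_dual[OF L])
    from limitin_strong_dual[OF L \<phi> this]
    have "uniform_limit (i ` topspace K) \<phi> (zero_functional L) sequentially"
      using * free_lcs_generators_bounded[OF K(1) free] by simp
    moreover have "zero_functional L v = 0" if "v \<in> i ` topspace K" for v
      using that free_lcs_generator[OF free] by (auto simp: zero_functional_def)
    ultimately have lim: "uniform_limit (i ` topspace K) \<phi> (\<lambda>_. 0) sequentially"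
      using uniform_limit_cong'[of "i ` topspace K" \<phi> \<phi> "zero_functional L" "\<lambda>_. 0"] by blast
    have "\<forall>\<^sub>F n in sequentially. \<forall>v\<in>i ` topspace K. dist (\<phi> n v) 0 < 1"
      using uniform_limitD[OF lim, of 1] by simp
    then obtain N where N: "\<And>n x. n \<ge> N \<Longrightarrow> x \<in> topspace K \<Longrightarrow> \<bar>\<phi> n (i x)\<bar> < 1"
      by (auto simp: eventually_sequentially)
    obtain b where b: "\<And>n x. x \<in> topspace K \<Longrightarrow> \<bar>\<phi> n (i x)\<bar> \<le> b n"
      using continuous_functional_bounded_on_generators[OF K(1) free \<phi>] by metis
    show "equicontinuous L (range \<phi>)"
    proof (rule free_lcs_uniformly_null_equicontinuous[OF free \<phi> lim])
      fix n x assume x: "x \<in> topspace K"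
      show "\<bar>\<phi> n (i x)\<bar> \<le> Max (insert 1 (b ` {..<N}))"
      proof (cases "n < N")
        case True
        then have "b n \<le> Max (insert 1 (b ` {..<N}))" by (intro Max_ge) auto
        with b[OF x] show ?thesis by (rule order_trans)
      next
        case False
        then have "\<bar>\<phi> n (i x)\<bar> \<le> 1" using N[of n x] x by simp
        also have "1 \<le> Max (insert 1 (b ` {..<N}))" by (intro Max_ge) auto
        finally show ?thesis .
      qed
    qed
  qed
qed

section \<open>The class G and metrizability\<close>

text \<open>If the union were uncountable, a branch \<open>\<gamma>\<close> could be chosen such that for every \<open>n\<close> the sets
  \<open>F \<alpha>\<close> with \<open>\<alpha>\<close> agreeing with \<open>\<gamma>\<close> below \<open>n\<close> still have an uncountable union, since there are only
  countably many values for the next entry.  Take \<open>n\<close> points of that union for each \<open>n\<close>.  The indices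
  witnessing these points take only finitely many values at each coordinate, because from stage \<open>k + 1\<close>
  on their \<open>k\<close>-th entry is \<open>\<gamma> k\<close>.  So they have a common upper bound \<open>\<delta>\<close>, and \<open>F \<delta>\<close> is infinite.\<close>

lemma finite_resolution_countable:
  fixes F :: "(nat \<Rightarrow> nat) \<Rightarrow> 'a set"
  assumes mono: "mono F" and fin: "\<And>\<alpha>. finite (F \<alpha>)"
  shows "countable (\<Union>\<alpha>. F \<alpha>)"
proof (rule ccontr)
  assume unc: "uncountable (\<Union>\<alpha>. F \<alpha>)"
  \<comment> \<open>the union over all indices that agree with \<open>\<beta>\<close> below \<open>n\<close>\<close>
  define T where "T = (\<lambda>n \<beta>. \<Union>\<alpha>\<in>{\<alpha>. \<forall>k<n. \<alpha> k = \<beta> k}. F \<alpha>)"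
  have step: "\<exists>\<beta>'. uncountable (T (Suc n) \<beta>') \<and> (\<forall>k<n. \<beta>' k = \<beta> k)" if "uncountable (T n \<beta>)" for n \<beta>
  proof -
    have "T n \<beta> \<subseteq> (\<Union>m. T (Suc n) (\<beta>(n := m)))"
    proof
      fix x assume "x \<in> T n \<beta>"
      then obtain \<alpha> where "\<forall>k<n. \<alpha> k = \<beta> k" "x \<in> F \<alpha>" by (auto simp: T_def)
      then have "x \<in> T (Suc n) (\<beta>(n := \<alpha> n))" by (auto simp: T_def less_Suc_eq)
      then show "x \<in> (\<Union>m. T (Suc n) (\<beta>(n := m)))" by blast
    qed
    then have "\<exists>m. uncountable (T (Suc n) (\<beta>(n := m)))"
      using that by (meson countable_UN countable_subset uncountable_def countableI_type)
    then obtain m where "uncountable (T (Suc n) (\<beta>(n := m)))" by blast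
    then show ?thesis by (intro exI[of _ "\<beta>(n := m)"]) auto
  qed
  have "\<exists>\<beta>. \<forall>n. uncountable (T n (\<beta> n)) \<and> (\<forall>k<n. \<beta> (Suc n) k = \<beta> n k)"
    by (rule dependent_nat_choice) (use unc step in \<open>auto simp: T_def\<close>)
  then obtain \<beta> where \<beta>: "\<And>n. uncountable (T n (\<beta> n))" "\<And>n k. k < n \<Longrightarrow> \<beta> (Suc n) k = \<beta> n k"
    by blast
  define \<gamma> where "\<gamma> = (\<lambda>k. \<beta> (Suc k) k)"
  have "\<beta> n k = \<gamma> k" if "k < n" for n k
    using that
  proof (induction n)
    case (Suc n)
    then show ?case by (cases "k = n") (auto simp: \<gamma>_def \<beta>(2))
  qed simp
  then have "T n (\<beta> n) = T n \<gamma>" for n by (auto simp: T_def)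
  then have "infinite (T n \<gamma>)" for n using \<beta>(1)[of n] by (metis countable_finite)
  then have "\<exists>P. finite P \<and> card P = n \<and> P \<subseteq> T n \<gamma>" for n
    using infinite_arbitrarily_large by blast
  then obtain P where P: "\<And>n. finite (P n)" "\<And>n. card (P n) = n" "\<And>n. P n \<subseteq> T n \<gamma>" by metis
  define \<alpha> where "\<alpha> = (\<lambda>n p. SOME a. (\<forall>k<n. a k = \<gamma> k) \<and> p \<in> F a)"
  have "\<exists>a. (\<forall>k<n. a k = \<gamma> k) \<and> p \<in> F a" if "p \<in> P n" for n p
    using P(3)[of n] that by (auto simp: T_def)
  then have \<alpha>: "(\<forall>k<n. \<alpha> n p k = \<gamma> k) \<and> p \<in> F (\<alpha> n p)" if "p \<in> P n" for n p
    unfolding \<alpha>_def by (rule someI_ex) (rule that)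
  define \<delta> where "\<delta> = (\<lambda>k. Max (insert (\<gamma> k) ((\<lambda>(n, p). \<alpha> n p k) ` (SIGMA n:{..k}. P n))))"
  have fins: "finite ((\<lambda>(n, p). \<alpha> n p k) ` (SIGMA n:{..k}. P n))" for k using P(1) by auto
  have "\<alpha> n p k \<le> \<delta> k" if "p \<in> P n" for n p k
  proof (cases "k < n")
    case True
    then show ?thesis using \<alpha>[OF that] fins[of k] by (simp add: \<delta>_def)
  next
    case False
    then have "\<alpha> n p k \<in> (\<lambda>(n, p). \<alpha> n p k) ` (SIGMA n:{..k}. P n)" using that by force
    then show ?thesis unfolding \<delta>_def using fins[of k] by (intro Max_ge) auto
  qed
  then have "F (\<alpha> n p) \<subseteq> F \<delta>" if "p \<in> P n" for n p
    using that by (intro monoD[OF mono]) (simp add: le_fun_def)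
  then have "P n \<subseteq> F \<delta>" for n using \<alpha> by blast
  then have "card (P n) \<le> card (F \<delta>)" for n by (intro card_mono fin)
  from this[of "Suc (card (F \<delta>))"] show False by (simp add: P(2))
qed

text \<open>The Arzela--Ascoli argument: up to \<open>e / 4\<close> a function of the sequence is determined by its values
  on a finite set \<open>X\<close> of points.  These values are bounded, so rounded to multiples of \<open>e / 4\<close> they
  take finitely many configurations, and two members of the sequence share one.\<close>

lemma equicontinuous_sequence_not_separated:
  assumes K: "compact_space K" and free: "free_lcs K L i"
    and eq: "equicontinuous L (range \<phi>)" and e: "e > 0"
  shows "\<exists>m n::nat. m \<noteq> n \<and> (\<forall>x\<in>topspace K. \<bar>\<phi> m (i x) - \<phi> n (i x)\<bar> < e)"
proof -
  have L: "lcs L" and i: "continuous_map K L i" using free by (auto simp: free_lcs_def)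
  obtain U where U: "openin L U" "0 \<in> U" "range \<phi> \<subseteq> polar L U"
    using eq by (auto simp: equicontinuous_def)
  then have \<phi>: "\<phi> n \<in> dual L" for n by (auto simp: polar_def)
  obtain r where r: "\<And>n x. x \<in> topspace K \<Longrightarrow> \<bar>\<phi> n (i x)\<bar> \<le> r"
    using equicontinuous_imp_uniformly_bounded[OF eq free_lcs_generators_bounded[OF K free]] by blast
  define W where "W = (\<lambda>x. {y \<in> topspace K. (4 / e) *\<^sub>R (i y + (- 1) *\<^sub>R i x) \<in> U})"
  have "openin K (W x)" if "x \<in> topspace K" for x
  proof -
    have "continuous_map K L (\<lambda>y. (4 / e) *\<^sub>R (i y + (- 1) *\<^sub>R i x))"
      using free_lcs_generator[OF free that] i
      by (intro continuous_map_lcs_scaleR[OF L] continuous_map_lcs_add[OF L]) auto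
    then show ?thesis unfolding W_def by (rule openin_continuous_map_preimage[OF _ U(1)])
  qed
  moreover have "x \<in> W x" if "x \<in> topspace K" for x using that U(2) by (simp add: W_def)
  ultimately have "\<exists>\<F>. finite \<F> \<and> \<F> \<subseteq> W ` topspace K \<and> topspace K \<subseteq> \<Union>\<F>"
    using K unfolding compact_space_def by (intro compactinD[of K "topspace K"]) auto
  then obtain X where X: "finite X" "X \<subseteq> topspace K" "topspace K \<subseteq> (\<Union>x\<in>X. W x)"
    by (metis finite_subset_image)
  have close: "\<bar>\<phi> n (i y) - \<phi> n (i x)\<bar> \<le> e / 4" if "x \<in> topspace K" "y \<in> W x" for n x y
  proof -
    have y: "y \<in> topspace K" and u: "(4 / e) *\<^sub>R (i y + (- 1) *\<^sub>R i x) \<in> U"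
      using that(2) by (auto simp: W_def)
    have sub: "subspace (topspace L)" using L by (simp add: lcs_def)
    have ix: "i x \<in> topspace L" "i y \<in> topspace L" using free_lcs_generator[OF free] that(1) y by auto
    have mx: "(- 1) *\<^sub>R i x \<in> topspace L" using ix sub subspace_scale by blast
    have "i y + (- 1) *\<^sub>R i x \<in> topspace L" using ix mx sub subspace_add by blast
    then have "\<phi> n ((4 / e) *\<^sub>R (i y + (- 1) *\<^sub>R i x)) = (4 / e) * (\<phi> n (i y) - \<phi> n (i x))"
      by (simp only: dual_scaleR[OF \<phi>] dual_add[OF \<phi> ix(2) mx] ix) simp
    moreover have "\<bar>\<phi> n ((4 / e) *\<^sub>R (i y + (- 1) *\<^sub>R i x))\<bar> \<le> 1"
      using U(3) u by (auto simp: polar_def)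
    ultimately have "\<bar>(4 / e) * (\<phi> n (i y) - \<phi> n (i x))\<bar> \<le> 1" by (simp only:)
    then have "(4 / e) * \<bar>\<phi> n (i y) - \<phi> n (i x)\<bar> \<le> 1" using e by (simp only: abs_mult) simp
    then show ?thesis using e by (simp add: field_simps)
  qed
  define q where "q = (\<lambda>n. restrict (\<lambda>x. \<lfloor>4 / e * \<phi> n (i x)\<rfloor>) X)"
  have "q n \<in> X \<rightarrow>\<^sub>E {\<lfloor>4 / e * (- r)\<rfloor>..\<lfloor>4 / e * r\<rfloor>}" for n
  proof -
    have "\<lfloor>4 / e * (- r)\<rfloor> \<le> \<lfloor>4 / e * \<phi> n (i x)\<rfloor> \<and> \<lfloor>4 / e * \<phi> n (i x)\<rfloor> \<le> \<lfloor>4 / e * r\<rfloor>"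
      if "x \<in> X" for x
    proof -
      have "- r \<le> \<phi> n (i x)" "\<phi> n (i x) \<le> r" using r[of x n] that X(2) by (auto simp: abs_le_iff)
      then show ?thesis using e by (intro conjI floor_mono mult_left_mono) auto
    qed
    then show ?thesis by (auto simp: q_def)
  qed
  then have "finite (range q)"
    by (intro finite_subset[OF image_subsetI finite_PiE[OF X(1) finite_atLeastAtMost_int]])
  then have "\<not> inj q" using finite_imageD infinite_UNIV_nat by blast
  then obtain m n where mn: "m \<noteq> n" "q m = q n" by (auto simp: inj_def)
  have "\<bar>\<phi> m (i y) - \<phi> n (i y)\<bar> < e" if y: "y \<in> topspace K" for y
  proof -
    obtain x where x: "x \<in> X" "y \<in> W x" using X(3) y by blast
    have "\<lfloor>4 / e * \<phi> m (i x)\<rfloor> = \<lfloor>4 / e * \<phi> n (i x)\<rfloor>"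
      using mn(2) x(1) by (metis q_def restrict_apply')
    then have "\<bar>4 / e * \<phi> m (i x) - 4 / e * \<phi> n (i x)\<bar> < 1" by linarith
    then have "\<bar>4 / e * (\<phi> m (i x) - \<phi> n (i x))\<bar> < 1" by (simp only: right_diff_distrib)
    then have "4 / e * \<bar>\<phi> m (i x) - \<phi> n (i x)\<bar> < 1" using e by (simp only: abs_mult) simp
    then have "\<bar>\<phi> m (i x) - \<phi> n (i x)\<bar> < e / 4" using e by (simp add: field_simps)
    moreover have "x \<in> topspace K" using x(1) X(2) by blast
    then have "\<bar>\<phi> m (i y) - \<phi> m (i x)\<bar> \<le> e / 4" "\<bar>\<phi> n (i y) - \<phi> n (i x)\<bar> \<le> e / 4"
      using close x(2) by blast+
    ultimately show ?thesis using e unfolding abs_le_iff abs_less_iff by linarith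
  qed
  then show ?thesis using mn(1) by blast
qed

text \<open>Evaluation embeds the space in a countable power of the real line.\<close>

lemma compact_metrizable_if_countably_separated:
  assumes K: "compact_space K" and S: "countable S"
    and cont: "\<And>s. s \<in> S \<Longrightarrow> continuous_map K euclideanreal (f s)"
    and sep: "\<And>x y. x \<in> topspace K \<Longrightarrow> y \<in> topspace K \<Longrightarrow> x \<noteq> y \<Longrightarrow> \<exists>s\<in>S. f s x \<noteq> (f s y :: real)"
  shows "metrizable_space K"
proof -
  let ?P = "product_topology (\<lambda>_. euclideanreal) S"
  define h where "h = (\<lambda>x. restrict (\<lambda>s. f s x) S)"
  have P: "metrizable_space ?P"
    using S by (auto simp: metrizable_space_product_topology metrizable_space_euclidean)
  have h: "continuous_map K ?P h"
    using cont by (auto simp: continuous_map_componentwise h_def)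
  have "inj_on h (topspace K)"
    using sep by (intro inj_onI) (metis h_def restrict_apply')
  moreover have "closed_map K ?P h"
    by (intro continuous_imp_closed_map h K metrizable_imp_Hausdorff_space P)
  ultimately have "embedding_map K ?P h"
    using h by (simp add: injective_closed_imp_embedding_map)
  then show ?thesis
    using embedding_map_imp_homeomorphic_space homeomorphic_metrizable_space
      metrizable_space_subtopology[OF P] by blast
qed

lemma free_lcs_class_G_imp_metrizable:
  assumes K: "compact_space K" "Hausdorff_space K" and free: "free_lcs K L i" and G: "class_G L"
  shows "metrizable_space K"
proof -
  obtain A :: "(nat \<Rightarrow> nat) \<Rightarrow> ('b \<Rightarrow> real) set"
    where A: "dual L = (\<Union>\<alpha>. A \<alpha>)" "mono A"
      "\<And>\<alpha> \<phi>::nat \<Rightarrow> 'b \<Rightarrow> real. range \<phi> \<subseteq> A \<alpha> \<Longrightarrow> equicontinuous L (range \<phi>)"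
    using G unfolding class_G_def by blast
  \<comment> \<open>The distance \<open>1 / 4\<close> suffices: approximating within it a function with values \<open>0\<close> at \<open>x\<close> and
    \<open>1\<close> at \<open>y\<close> still separates \<open>x\<close> from \<open>y\<close>.\<close>
  define far where "far = (\<lambda>\<phi> \<psi>. \<exists>x\<in>topspace K. \<bar>\<phi> (i x) - \<psi> (i x)\<bar> \<ge> (1 / 4 :: real))"
  have far_sym: "far \<psi> \<phi>" if "far \<phi> \<psi>" for \<phi> \<psi>
    using that by (simp add: far_def abs_minus_commute)
  have "\<exists>S\<in>{S. S \<subseteq> dual L \<and> pairwise far S}. \<forall>X\<in>{S. S \<subseteq> dual L \<and> pairwise far S}. S \<subseteq> X \<longrightarrow> X = S"
  proof (rule subset_Zorn')
    fix C assume C: "subset.chain {S. S \<subseteq> dual L \<and> pairwise far S} C"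
    then have "pairwise far (\<Union>C)"
      by (intro pairwise_chain_Union) (auto simp: subset_chain_def chain_subset_def)
    then show "\<Union>C \<in> {S. S \<subseteq> dual L \<and> pairwise far S}"
      using C by (auto simp: subset_chain_def)
  qed
  then obtain S where "S \<in> {S. S \<subseteq> dual L \<and> pairwise far S}"
      and "\<forall>X\<in>{S. S \<subseteq> dual L \<and> pairwise far S}. S \<subseteq> X \<longrightarrow> X = S" by (rule bexE)
  then have S: "S \<subseteq> dual L" "pairwise far S"
    and maxl: "X \<subseteq> dual L \<Longrightarrow> pairwise far X \<Longrightarrow> S \<subseteq> X \<Longrightarrow> X = S" for X by simp_all
  have near: "\<exists>\<psi>\<in>S. \<forall>x\<in>topspace K. \<bar>\<phi> (i x) - \<psi> (i x)\<bar> < 1 / 4" if \<phi>: "\<phi> \<in> dual L" for \<phi>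
  proof (cases "\<phi> \<in> S")
    case True
    then show ?thesis by (intro bexI[of _ \<phi>]) auto
  next
    case False
    then have "\<not> pairwise far (insert \<phi> S)" using maxl[of "insert \<phi> S"] \<phi> S(1) by blast
    then obtain \<psi> where "\<psi> \<in> S" "\<not> far \<phi> \<psi>"
      using S(2) far_sym by (auto simp: pairwise_insert)
    then show ?thesis by (auto simp: far_def not_le)
  qed
  have "finite (A \<alpha> \<inter> S)" for \<alpha>
  proof (rule ccontr)
    assume "infinite (A \<alpha> \<inter> S)"
    then obtain \<phi> :: "nat \<Rightarrow> 'b \<Rightarrow> real" where \<phi>: "inj \<phi>" "range \<phi> \<subseteq> A \<alpha> \<inter> S"
      by (auto dest: infinite_countable_subset)
    then obtain m n where mn: "m \<noteq> n" "\<forall>x\<in>topspace K. \<bar>\<phi> m (i x) - \<phi> n (i x)\<bar> < 1 / 4"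
      using equicontinuous_sequence_not_separated[OF K(1) free A(3), of \<phi> \<alpha> "1 / 4"] by auto
    have "far (\<phi> m) (\<phi> n)"
      using \<phi> mn(1) by (intro pairwiseD[OF S(2)]) (auto dest: injD)
    then show False using mn(2) by (force simp: far_def)
  qed
  then have "countable (\<Union>\<alpha>. A \<alpha> \<inter> S)"
    using A(2) by (intro finite_resolution_countable) (auto simp: mono_def)
  moreover have "(\<Union>\<alpha>. A \<alpha> \<inter> S) = S" using A(1) S(1) by blast
  ultimately have "countable S" by simp
  then show ?thesis
  proof (rule compact_metrizable_if_countably_separated[OF K(1), where f = "\<lambda>\<psi> x. \<psi> (i x)"])
    show "continuous_map K euclideanreal (\<lambda>x. \<psi> (i x))" if "\<psi> \<in> S" for \<psi>
      using that S(1) free continuous_map_compose[of K L i euclideanreal \<psi>]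
      by (auto simp: dual_def operators_def free_lcs_def o_def)
    fix x y assume xy: "x \<in> topspace K" "y \<in> topspace K" "x \<noteq> y"
    have K': "normal_space K" "t1_space K"
      using K by (simp_all add: compact_Hausdorff_or_regular_imp_normal_space Hausdorff_imp_t1_space)
    obtain f where f: "continuous_map K euclideanreal f"
        "\<And>z. z \<in> {x, y} \<Longrightarrow> f z = (if z = y then 1 else 0)"
      by (rule normal_T1_finite_interpolation[OF K', of "{x, y}" "\<lambda>z. if z = y then 1 else 0"])
        (use xy in auto)
    obtain \<phi> where \<phi>: "\<phi> \<in> dual L" "\<And>z. z \<in> topspace K \<Longrightarrow> \<phi> (i z) = f z"
      using free_lcs_dual_extension[OF free f(1)] by blast
    obtain \<psi> where "\<psi> \<in> S" "\<forall>z\<in>topspace K. \<bar>\<phi> (i z) - \<psi> (i z)\<bar> < 1 / 4"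
      using near[OF \<phi>(1)] by blast
    then have "\<psi> \<in> S" "\<bar>0 - \<psi> (i x)\<bar> < 1 / 4" "\<bar>1 - \<psi> (i y)\<bar> < 1 / 4"
      using xy \<phi>(2) f(2) by auto
    then show "\<exists>\<psi>\<in>S. \<psi> (i x) \<noteq> \<psi> (i y)" by (intro bexI[of _ \<psi>]) auto
  qed
qed

theorem proposition3p7:
  fixes K :: "'k topology" and L :: "'v::real_vector topology" and i :: "'k \<Rightarrow> 'v"
  assumes "compact_space K" and "Hausdorff_space K" and "\<not> metrizable_space K"
    and "free_lcs K L i"
  shows "df_space L \<and> \<not> quasi_DF_space L"
  using free_lcs_df_space[OF assms(1,2,4)] free_lcs_class_G_imp_metrizable[OF assms(1,2,4)] assms(3)
  unfolding quasi_DF_space_def by blast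

end
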